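(* Let $\mathcal{S}\subset\mathbb{Z}$ with $\max\mathcal{S}=1$. Let $\ell\le 0\le r$ and let $(n_i)_{\ell\le i\le r}$ be a sequence of positive integers. If $\min\mathcal{S}=-1$ or $\ell=0$, the number of $\mathcal{S}$-ary trees having vertical profile $(n_\ell,\ldots,n_{-1};n_0,n_1,\ldots,n_r)$ is $$\frac{n_0}{n_\ell n_r}\binom{\sum_{s\in\mathcal{S}}n_{-s}}{n_0-1}\prod_{\substack{\ell\le i\le r\\ i\ne 0}}\binom{\sum_{s\in\mathcal{S}}n_{i-s}-1}{n_i-1},$$ with $n_i=0$ if $i<\ell$ or $i>r$.
   Context: A rooted Cayley tree of size $n$ is a tree on vertex set $\{1,\ldots,n\}$ with a distinguished root. For $\mathcal{S}\subset\mathbb{Z}$, an $\mathcal{S}$-embedded Cayley tree is a rooted Cayley tree with abscissas $a(v)\in\mathbb{Z}$ such that the root has abscissa $0$ and $a(v')-a(v)\in\mathcal{S}$ whenever $v'$ is a child of $v$. It is injective if every vertex $v$ has at most one child at abscissa $a(v)+s$ for each $s\in\mathcal{S}$. Two $\mathcal{S}$-embedded Cayley trees of size $n$ are equivalent if there is a bijection $f$ of $\{1,\ldots,n\}$ such that $w$ is the parent of $v$ in the first iff $f(w)$ is the parent of $f(v)$ in the second, and $v$ and $f(v)$ have the same abscissa. An $\mathcal{S}$-ary tree is an equivalence class of injective $\mathcal{S}$-embedded Cayley trees (equivalently, an unlabelled rooted tree with root at abscissa $0$ in which each vertex $v$ has at most one child at abscissa $a(v)+s$ for each $s\in\mathcal{S}$).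 The vertical profile $(n_\ell,\ldots,n_{-1};n_0,\ldots,n_r)$ records the number $n_i$ of vertices at abscissa $i$, with $\ell$, $r$ the minimal and maximal abscissas. *)

theory Defs
  imports Complex_Main "HOL-Library.FuncSet"
begin

definition is_path :: "nat set set \<Rightarrow> nat \<Rightarrow> nat list \<Rightarrow> nat \<Rightarrow> bool" where
  "is_path E u p v \<longleftrightarrow>
     p \<noteq> [] \<and> hd p = u \<and> last p = v \<and> distinct p \<and> successively (\<lambda>x y. {x, y} \<in> E) p"

text \<open>A tree is a simple graph in which any two vertices are joined by exactly one path.
  The predicate \<open>tree\<close> of the AFP entry Graph-Theory only forbids directed cycles, so it is not
  the notion of an undirected tree.\<close>

definition is_tree :: "nat set \<Rightarrow> nat set set \<Rightarrow> bool" where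
  "is_tree V E \<longleftrightarrow>
     V \<noteq> {} \<and> E \<subseteq> {e. e \<subseteq> V \<and> card e = 2} \<and> (\<forall>u\<in>V. \<forall>v\<in>V. \<exists>!p. is_path E u p v)"

record emb_tree =
  tsize :: nat
  edges :: "nat set set"
  root  :: nat
  absc  :: "nat \<Rightarrow> int"

definition verts :: "emb_tree \<Rightarrow> nat set" where
  "verts T = {1..tsize T}"

text \<open>The parent of a vertex is its predecessor on the path that joins the root to it.\<close>

definition is_parent :: "emb_tree \<Rightarrow> nat \<Rightarrow> nat \<Rightarrow> bool" where
  "is_parent T w v \<longleftrightarrow> (\<exists>p. is_path (edges T) (root T) (p @ [w, v]) v)"

definition rooted_Cayley_tree :: "emb_tree \<Rightarrow> bool" where
  "rooted_Cayley_tree T \<longleftrightarrow> is_tree (verts T) (edges T) \<and> root T \<in> verts T"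

text \<open>Abscissas only make sense on the vertex set, hence the extensionality condition.\<close>

definition S_embedded :: "int set \<Rightarrow> emb_tree set" where
  "S_embedded S = {T. rooted_Cayley_tree T \<and> absc T \<in> extensional (verts T) \<and>
     absc T (root T) = 0 \<and>
     (\<forall>v\<in>verts T. \<forall>w\<in>verts T. is_parent T v w \<longrightarrow> absc T w - absc T v \<in> S)}"

definition injective_S_embedded :: "int set \<Rightarrow> emb_tree set" where
  "injective_S_embedded S = {T \<in> S_embedded S. \<forall>v\<in>verts T. \<forall>s\<in>S.
     card {w \<in> verts T. is_parent T v w \<and> absc T w = absc T v + s} \<le> 1}"

definition emb_equiv :: "int set \<Rightarrow> (emb_tree \<times> emb_tree) set" where
  "emb_equiv S = {(T, T'). T \<in> S_embedded S \<and> T' \<in> S_embedded S \<and> tsize T = tsize T' \<and>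
     (\<exists>f. bij_betw f (verts T) (verts T') \<and>
        (\<forall>v\<in>verts T. \<forall>w\<in>verts T. is_parent T w v \<longleftrightarrow> is_parent T' (f w) (f v)) \<and>
        (\<forall>v\<in>verts T. absc T' (f v) = absc T v))}"

definition S_ary_trees :: "int set \<Rightarrow> emb_tree set set" where
  "S_ary_trees S = injective_S_embedded S // emb_equiv S"

definition has_profile :: "emb_tree \<Rightarrow> int \<Rightarrow> int \<Rightarrow> (int \<Rightarrow> nat) \<Rightarrow> bool" where
  "has_profile T l r n \<longleftrightarrow>
     Min (absc T ` verts T) = l \<and> Max (absc T ` verts T) = r \<and>
     (\<forall>i\<in>{l..r}. card {v \<in> verts T. absc T v = i} = n i)"

text \<open>The profile is invariant under \<^const>\<open>emb_equiv\<close>, so it may be read off any representative.\<close>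

definition S_ary_trees_with_profile ::
    "int set \<Rightarrow> int \<Rightarrow> int \<Rightarrow> (int \<Rightarrow> nat) \<Rightarrow> emb_tree set set" where
  "S_ary_trees_with_profile S l r n = {C \<in> S_ary_trees S. \<exists>T\<in>C. has_profile T l r n}"

text \<open>The sum of \<open>n (i - s)\<close> over all \<open>s\<close> in \<open>S\<close>. As \<open>S\<close> may be unbounded below, the
  zero terms are left out to keep the index set finite.\<close>

definition shifted_sum :: "int set \<Rightarrow> (int \<Rightarrow> nat) \<Rightarrow> int \<Rightarrow> nat" where
  "shifted_sum S n i = (\<Sum>s | s \<in> S \<and> n (i - s) \<noteq> 0. n (i - s))"

end

theory Submission
  imports Defs
begin

text \<open>An injective embedded tree has no nontrivial automorphism, so it suffices to count the trees
  whose vertices carry prescribed abscissas and to divide by \<open>\<Prod> n\<^sub>i!\<close>. Such a labelled tree is an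
  injective map from vertices to slots, where every vertex \<open>w\<close> offers one slot at each
  \<open>a w + s\<close> and one extra slot at abscissa \<open>0\<close> receives the root, subject to acyclicity.

  Acyclic maps are counted by contracting one vertex \<open>v\<close> at a time, in order of decreasing
  \<open>\<bar>a v\<bar>\<close>, into the owner of its slot. Suppose \<open>v\<close> is at abscissa \<open>i\<close>, there are \<open>N\<close> slots at \<open>i\<close>, of which
  \<open>k\<close> are owned by vertices closer to \<open>0\<close> and \<open>d\<close> by \<open>v\<close> itself. Contraction changes \<open>k\<close> into \<open>k - 1 + d\<close> for
  \<open>k\<close> choices of the slot, leaves it unchanged for \<open>N - k - d\<close> choices, and does not affect the other
  abscissas. As \<open>k (k - 1 + d) + (N - k - d) k = k (N - 1)\<close>, every abscissa contributes
  \<open>k (N - 1) (N - 2) \<cdots> (N - n + 1)\<close> if there are \<open>n\<close> vertices at it.\<close>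

section \<open>Acyclic slot assignments\<close>

text \<open>A cycle without a loop at \<open>v\<close> becomes a cycle of \<open>R'\<close> when
  every passage \<open>x\<close>, \<open>v\<close>, \<open>y\<close> is shortened to
  \<open>x\<close>, \<open>y\<close>; conversely each pair of \<open>R'\<close> is a path of length
  one or two in \<open>R\<close>. A loop at \<open>v\<close> is the only cycle that contraction
  loses.\<close>

lemma acyclic_contract_vertex:
  fixes R :: "('a \<times> 'a) set"
  assumes R': "R' = {(x, y). x \<noteq> v \<and> y \<noteq> v \<and> ((x, y) \<in> R \<or> (x, v) \<in> R \<and> (v, y) \<in> R)}"
  shows "acyclic R \<longleftrightarrow> (v, v) \<notin> R \<and> acyclic R'"
proof safe
  assume "acyclic R" "(v, v) \<in> R"
  then show False by (auto simp: acyclic_def)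
next
  assume ac: "acyclic R"
  have "R' \<subseteq> R\<^sup>+" unfolding R' by (auto intro: trancl_trans)
  then have "R'\<^sup>+ \<subseteq> R\<^sup>+" by (metis trancl_id trancl_mono_subset trans_trancl)
  then show "acyclic R'" using ac by (auto simp: acyclic_def)
next
  assume vv: "(v, v) \<notin> R" and ac: "acyclic R'"
  \<comment> \<open>An \<open>R\<close>-walk is shadowed by an \<open>R'\<close>-walk that skips
    \<open>v\<close>. While the walk stands at \<open>v\<close>, the shadow waits at the predecessor
    \<open>w\<close>.\<close>
  have step: "(y \<noteq> v \<longrightarrow> (x, y) \<in> R'\<^sup>+) \<and> (y = v \<longrightarrow> (\<exists>w. w \<noteq> v \<and> (x, w) \<in> R'\<^sup>* \<and> (w, v) \<in> R))"
    if "(x, y) \<in> R\<^sup>+" "x \<noteq> v" for x y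
    using that
  proof (induction rule: trancl_induct)
    case (base y)
    then show ?case unfolding R' by (auto intro: r_into_trancl)
  next
    case (step y z)
    show ?case
    proof (cases "y = v")
      case True
      then obtain w where w: "w \<noteq> v" "(x, w) \<in> R'\<^sup>*" "(w, v) \<in> R" using step by blast
      have "z \<noteq> v" using True step.hyps vv by auto
      then have "(w, z) \<in> R'" using w True step.hyps unfolding R' by auto
      with w \<open>z \<noteq> v\<close> show ?thesis by (meson rtrancl_into_trancl1)
    next
      case False
      then have xy: "(x, y) \<in> R'\<^sup>+" using step by auto
      show ?thesis
      proof (cases "z = v")
        case True
        with xy False step.hyps show ?thesis by (auto intro: trancl_into_rtrancl)
      next
        case z: False
        then have "(y, z) \<in> R'" using False step.hyps unfolding R' by auto
        with xy z show ?thesis by auto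
      qed
    qed
  qed
  show "acyclic R"
    unfolding acyclic_def
  proof (rule allI, rule notI)
    fix x assume xx: "(x, x) \<in> R\<^sup>+"
    have *: False if "(y, y) \<in> R\<^sup>+" "y \<noteq> v" for y
      using step[OF that] ac that by (auto simp: acyclic_def)
    show False
    proof (cases "x = v")
      \<comment> \<open>A cycle through \<open>v\<close> is rotated so that it starts at the
        successor of \<open>v\<close>.\<close>
      case True
      then obtain y where y: "(v, y) \<in> R" "(y, v) \<in> R\<^sup>*" using xx by (meson tranclD)
      then have "y \<noteq> v" using vv by auto
      moreover have "(y, y) \<in> R\<^sup>+" using y by (meson rtrancl_into_trancl1)
      ultimately show False using * by blast
    qed (use * xx in blast)
  qed
qed

text \<open>Slots are the places where a child may be attached; a slot with owner \<open>None\<close> is the place of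
  the root.\<close>

definition slot_maps ::
  "('v \<Rightarrow> 'k) \<Rightarrow> ('q \<Rightarrow> 'k) \<Rightarrow> ('q \<Rightarrow> 'v option) \<Rightarrow> 'v set \<Rightarrow> 'q set \<Rightarrow> ('v \<Rightarrow> 'q) set" where
  "slot_maps tv tq ow V Q = {f \<in> V \<rightarrow>\<^sub>E Q. inj_on f V \<and> (\<forall>v\<in>V. tq (f v) = tv v) \<and>
     acyclic {(v, u). v \<in> V \<and> ow (f v) = Some u}}"

text \<open>When \<open>v\<close> is placed in the slot \<open>q\<close>, contracting \<open>v\<close> into the owner of \<open>q\<close> hands over all slots
  of \<open>v\<close>.\<close>

definition merge_owner :: "'v \<Rightarrow> 'q \<Rightarrow> ('q \<Rightarrow> 'v option) \<Rightarrow> 'q \<Rightarrow> 'v option" where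
  "merge_owner v q ow = (\<lambda>q'. if ow q' = Some v then ow q else ow q')"

text \<open>The slot \<open>q\<close> of \<open>v\<close> and the map on the other vertices
  determine the whole map. It is acyclic iff the rest is acyclic after the slots of \<open>v\<close>
  pass to the owner of \<open>q\<close>, and \<open>ow q \<noteq> Some v\<close> excludes a loop at
  \<open>v\<close>.\<close>

lemma slot_maps_remove_vertex:
  assumes v: "v \<in> V"
  shows "bij_betw (\<lambda>f. (f v, restrict f (V - {v}))) (slot_maps tv tq ow V Q)
    (SIGMA q : {q \<in> Q. tq q = tv v \<and> ow q \<noteq> Some v}.
       slot_maps tv tq (merge_owner v q ow) (V - {v}) (Q - {q}))"
proof -
  let ?W = "V - {v}"
  let ?R = "\<lambda>f. {(x, u). x \<in> V \<and> ow (f x) = Some u}"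
  let ?R' = "\<lambda>q f. {(x, u). x \<in> ?W \<and> merge_owner v q ow (f x) = Some u}"
  have key: "acyclic (?R f) \<longleftrightarrow> ow (f v) \<noteq> Some v \<and> acyclic (?R' (f v) (restrict f ?W))"
    if "f \<in> V \<rightarrow> Q" for f
  proof (cases "ow (f v) = Some v")
    case True
    then have "(v, v) \<in> ?R f" using v by auto
    then show ?thesis using True by (auto simp: acyclic_def)
  next
    case False
    \<comment> \<open>Merging owners realises contraction at \<open>v\<close>. If the slot of
      \<open>v\<close> has no owner, no pair leaves \<open>v\<close>, and its children become
      ownerless accordingly.\<close>
    have "?R' (f v) (restrict f ?W) =
      {(x, y). x \<noteq> v \<and> y \<noteq> v \<and> ((x, y) \<in> ?R f \<or> (x, v) \<in> ?R f \<and> (v, y) \<in> ?R f)}"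
      using False v by (auto simp: merge_owner_def split: if_splits)
    from acyclic_contract_vertex[OF this] show ?thesis using False v by auto
  qed
  show ?thesis
  proof (rule bij_betw_byWitness[where f' = "\<lambda>(q, g). g(v := q)"])
    show "\<forall>f\<in>slot_maps tv tq ow V Q.
       (case (f v, restrict f ?W) of (q, g) \<Rightarrow> g(v := q)) = f"
      using v by (auto simp: slot_maps_def fun_eq_iff PiE_def extensional_def)
    show "\<forall>a\<in>SIGMA q : {q \<in> Q. tq q = tv v \<and> ow q \<noteq> Some v}.
         slot_maps tv tq (merge_owner v q ow) ?W (Q - {q}).
       (((case a of (q, g) \<Rightarrow> g(v := q)) v),
         restrict (case a of (q, g) \<Rightarrow> g(v := q)) ?W) = a"
      by (auto simp: slot_maps_def fun_eq_iff PiE_def extensional_def)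
    show "(\<lambda>f. (f v, restrict f ?W)) ` slot_maps tv tq ow V Q
      \<subseteq> (SIGMA q : {q \<in> Q. tq q = tv v \<and> ow q \<noteq> Some v}.
         slot_maps tv tq (merge_owner v q ow) ?W (Q - {q}))"
    proof (rule image_subsetI)
      fix f assume f: "f \<in> slot_maps tv tq ow V Q"
      then have fVQ: "f \<in> V \<rightarrow> Q" and inj: "inj_on f V" by (auto simp: slot_maps_def)
      have "restrict f ?W \<in> ?W \<rightarrow>\<^sub>E Q - {f v}"
        using fVQ inj v by (auto simp: inj_on_def)
      moreover have "inj_on (restrict f ?W) ?W" using inj by (auto simp: inj_on_def)
      ultimately show "(f v, restrict f ?W) \<in> (SIGMA q : {q \<in> Q. tq q = tv v \<and> ow q \<noteq> Some v}.
         slot_maps tv tq (merge_owner v q ow) ?W (Q - {q}))"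
        using f v fVQ key[OF fVQ] unfolding slot_maps_def by auto
    qed
    show "(\<lambda>(q, g). g(v := q)) ` (SIGMA q : {q \<in> Q. tq q = tv v \<and> ow q \<noteq> Some v}.
         slot_maps tv tq (merge_owner v q ow) ?W (Q - {q})) \<subseteq> slot_maps tv tq ow V Q"
    proof (rule image_subsetI, clarify)
      fix q g assume q: "q \<in> Q" "tq q = tv v" "ow q \<noteq> Some v"
        and g: "g \<in> slot_maps tv tq (merge_owner v q ow) ?W (Q - {q})"
      let ?f = "g(v := q)"
      have gP: "g \<in> ?W \<rightarrow>\<^sub>E Q - {q}" and inj: "inj_on g ?W"
        using g by (auto simp: slot_maps_def)
      have fVQ: "?f \<in> V \<rightarrow>\<^sub>E Q" using gP q v by (auto simp: PiE_def extensional_def)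
      have "inj_on ?f V" using gP inj by (auto simp: inj_on_def)
      moreover have "restrict ?f ?W = g" using gP by (auto simp: fun_eq_iff PiE_def extensional_def)
      moreover have "\<forall>x\<in>V. tq (?f x) = tv x" using g q by (auto simp: slot_maps_def)
      ultimately show "?f \<in> slot_maps tv tq ow V Q"
        using key[of ?f] fVQ g q by (auto simp: slot_maps_def)
    qed
  qed
qed

text \<open>This evaluates the sum over the slots of the contracted vertex, with the falling
  factorial from \<open>N - 1\<close> down to \<open>N - n + 1\<close> written as
  \<open>fact (n - 1) * ((N - 1) choose (n - 1))\<close>. The case \<open>k = 0\<close> is separate
  because \<open>k - 1\<close> is truncated; both sides then vanish.\<close>

lemma fact_binomial_step:
  assumes "n \<ge> 2" "k + d \<le> N"
  shows "(k * (k - 1 + d) + (N - k - d) * k) * (fact (n - 2) * ((N - 2) choose (n - 2)))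
    = k * (fact (n - 1) * ((N - 1) choose (n - 1)) :: nat)"
proof (cases "k = 0")
  case False
  have 1: "k * (k - 1 + d) + (N - k - d) * k = k * (N - 1)"
  proof -
    have "k - 1 + d + (N - k - d) = N - 1" using False assms by auto
    then show ?thesis by (metis add_mult_distrib2 mult.commute)
  qed
  obtain m where m: "n = Suc (Suc m)" using assms by (metis add_2_eq_Suc le_Suc_ex)
  show ?thesis
  proof (cases "N \<le> 1")
    case True
    then have "N - 1 = 0" by auto
    then show ?thesis unfolding 1 unfolding m by simp
  next
    case False
    then obtain M where M: "N = Suc (Suc M)" by (metis add_2_eq_Suc le_Suc_ex not_less_eq_eq one_add_one plus_1_eq_Suc)
    have "Suc M * (fact m * (M choose m)) = fact m * (Suc m * (Suc M choose Suc m))"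
      using Suc_times_binomial[of m M] by (simp del: binomial_Suc_Suc mult_Suc)
    then have "Suc M * (fact m * (M choose m)) = fact (Suc m) * (Suc M choose Suc m)"
      by (simp del: binomial_Suc_Suc mult_Suc add: mult.assoc mult.left_commute)
    then show ?thesis unfolding 1 unfolding m M by (simp del: fact_Suc binomial_Suc_Suc mult_Suc mult_Suc_right add: mult.assoc)
  qed
qed simp

text \<open>The types form a forest given by \<open>pr\<close>, and \<open>D i j\<close> says that \<open>j\<close> is \<open>i\<close> or one of its
  descendants. Removing vertices of maximal rank first keeps the following invariant: a slot of
  type \<open>i\<close> is owned by a vertex of type \<open>pr i\<close> (or by nobody if \<open>pr i = None\<close>), or by a vertex whose
  type descends from \<open>i\<close>.\<close>

locale type_forest =
  fixes pr :: "'k \<Rightarrow> 'k option" and D :: "'k \<Rightarrow> 'k \<Rightarrow> bool" and rank :: "'k \<Rightarrow> nat"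
  assumes pr_rank: "pr i = Some j \<Longrightarrow> rank j < rank i"
    and D_step: "D i j \<Longrightarrow> i \<noteq> j \<Longrightarrow> \<exists>j'. pr j = Some j' \<and> D i j'"
    and D_rank: "D i j \<Longrightarrow> rank j \<le> rank i \<Longrightarrow> i = j"
begin

text \<open>The number of these slots is the factor \<open>k\<close> of the counting argument. Using
  \<open>map_option\<close> lets one equation also cover ownerless slots, which are the entries to
  the root types.\<close>

definition entry_slots :: "('v \<Rightarrow> 'k) \<Rightarrow> ('q \<Rightarrow> 'k) \<Rightarrow> ('q \<Rightarrow> 'v option) \<Rightarrow> 'q set \<Rightarrow> 'k \<Rightarrow> 'q set" where
  "entry_slots tv tq ow Q i = {q \<in> Q. tq q = i \<and> map_option tv (ow q) = pr i}"

lemma D_rank_le: "D i j \<Longrightarrow> rank i \<le> rank j"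
  using D_rank[of i j] by (cases "rank j \<le> rank i") auto

text \<open>Induction on the number of vertices, always contracting a vertex of maximal rank.
  Contraction changes the entry slots only at the type of this vertex, so the product over the other
  types is a constant factor in the sum over its slots.\<close>

theorem card_slot_maps:
  assumes "finite V" "finite Q"
    and "\<And>q u. q \<in> Q \<Longrightarrow> ow q = Some u \<Longrightarrow> u \<in> V"
    and "\<And>q. q \<in> Q \<Longrightarrow> tq q \<in> tv ` V \<Longrightarrow>
      map_option tv (ow q) = pr (tq q) \<or> (\<exists>u. ow q = Some u \<and> D (tq q) (tv u))"
  shows "card (slot_maps tv tq ow V Q) =
    (\<Prod>i\<in>tv ` V. card (entry_slots tv tq ow Q i) *
       (fact (card {v \<in> V. tv v = i} - 1) *
         ((card {q \<in> Q. tq q = i} - 1) choose (card {v \<in> V. tv v = i} - 1))))"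
  using assms
proof (induction "card V" arbitrary: V Q ow)
  case 0
  then have "V = {}" by simp
  then have "slot_maps tv tq ow V Q = {\<lambda>_. undefined}"
    by (auto simp: slot_maps_def acyclic_def)
  then show ?case using \<open>V = {}\<close> by simp
next
  case (Suc m)
  note own = Suc.prems(3) and typed = Suc.prems(4)
  have "V \<noteq> {}" using Suc.hyps by auto
  \<comment> \<open>By maximality, no type still present has the type of \<open>v\<close> as parent
    or is a proper descendant of it. So a slot of this type is an entry slot or belongs to a vertex
    of the same type.\<close>
  obtain v where v: "v \<in> V" and vmax: "\<And>u. u \<in> V \<Longrightarrow> rank (tv u) \<le> rank (tv v)"
  proof -
    have "Max ((rank \<circ> tv) ` V) \<in> (rank \<circ> tv) ` V"
      using \<open>V \<noteq> {}\<close> Suc.prems by (intro Max_in) auto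
    then obtain v where "v \<in> V" "rank (tv v) = Max ((rank \<circ> tv) ` V)" by auto
    then show ?thesis using that Suc.prems(1) by (metis Max_ge comp_apply finite_imageI imageI)
  qed
  define r where "r = tv v"
  let ?W = "V - {v}"
  let ?E = "entry_slots tv tq ow Q"
  \<comment> \<open>The cardinalities of \<open>?E r\<close>, \<open>Qr\<close> and
    \<open>Dv\<close> are the \<open>k\<close>, \<open>N\<close> and \<open>d\<close> of the
    counting argument.\<close>
  define Qr where "Qr = {q \<in> Q. tq q = r}"
  define Dv where "Dv = {q \<in> Qr. ow q = Some v}"
  define F where "F = (\<lambda>i. card (?E i) * (fact (card {v \<in> V. tv v = i} - 1) *
         ((card {q \<in> Q. tq q = i} - 1) choose (card {v \<in> V. tv v = i} - 1))))"
  have finV: "finite V" "finite Q" using Suc.prems by auto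
  have finQr: "finite Qr" using finV by (auto simp: Qr_def)
  have EQr: "?E r = {q \<in> Qr. map_option tv (ow q) = pr r}" by (auto simp: entry_slots_def Qr_def)
  have Qr_cases: "q \<in> ?E r \<or> (\<exists>u\<in>V. ow q = Some u \<and> tv u = r)" if "q \<in> Qr" for q
  proof -
    have q: "q \<in> Q" "tq q = r" using that by (auto simp: Qr_def)
    then consider "map_option tv (ow q) = pr r" | u where "ow q = Some u" "D r (tv u)"
      using typed[of q] v r_def by auto
    then show ?thesis
    proof cases
      case 2
      then have "u \<in> V" using own q by auto
      then have "r = tv u" using D_rank[OF 2(2)] vmax[of u] r_def by auto
      then show ?thesis using 2 \<open>u \<in> V\<close> by auto
    qed (use q in \<open>auto simp: entry_slots_def\<close>)
  qed
  have pr_r: "pr r \<noteq> Some r" using pr_rank by blast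
  have disj: "?E r \<inter> Dv = {}"
    using pr_r by (auto simp: EQr Dv_def r_def[symmetric])
  have below: "pr i \<noteq> Some r" if "i \<in> tv ` V" for i
    using pr_rank[of i r] vmax that by (force simp: r_def)
  have IH: "card (slot_maps tv tq (merge_owner v q ow) ?W (Q - {q})) =
      (\<Prod>i\<in>tv ` ?W. card (entry_slots tv tq (merge_owner v q ow) (Q - {q}) i) *
       (fact (card {x \<in> ?W. tv x = i} - 1) *
         ((card {q' \<in> Q - {q}. tq q' = i} - 1) choose (card {x \<in> ?W. tv x = i} - 1))))"
    if q: "q \<in> Qr - Dv" for q
  proof (rule Suc.hyps(1))
    show "m = card ?W" using Suc.hyps(2) v finV by auto
    show "finite ?W" "finite (Q - {q})" using finV by auto
    show "u \<in> ?W" if "q' \<in> Q - {q}" "merge_owner v q ow q' = Some u" for q' u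
      using that q own by (auto simp: merge_owner_def Dv_def Qr_def split: if_splits)
    fix q' assume q': "q' \<in> Q - {q}" "tq q' \<in> tv ` ?W"
    have qq: "map_option tv (ow q) = pr r \<or> (\<exists>u\<in>V. ow q = Some u \<and> tv u = r)"
      using Qr_cases[of q] q by (auto simp: EQr)
    show "map_option tv (merge_owner v q ow q') = pr (tq q') \<or>
      (\<exists>u. merge_owner v q ow q' = Some u \<and> D (tq q') (tv u))"
    proof (cases "ow q' = Some v")
      case True
      \<comment> \<open>A slot of \<open>v\<close> whose type is still present is no entry slot, so
        its type is \<open>r\<close> or has \<open>r\<close> as a descendant. If the new owner has
        the parent type of \<open>r\<close>, then \<open>D_step\<close> gives the invariant, unless
        the slot has type \<open>r\<close> and becomes an entry slot.\<close>
      have "D (tq q') r"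
        using typed[of q'] q' True below[of "tq q'"] by (auto simp: r_def)
      then show ?thesis
        using qq True D_step[of "tq q'" r]
        by (cases "tq q' = r") (auto simp: merge_owner_def)
    next
      case False
      then show ?thesis using typed[of q'] q' by (auto simp: merge_owner_def)
    qed
  qed
  have E_other: "entry_slots tv tq (merge_owner v q ow) (Q - {q}) i = ?E i"
    if q: "q \<in> Qr - Dv" and i: "i \<in> tv ` V" "i \<noteq> r" for q i
  proof -
    have "map_option tv (merge_owner v q ow q') = pr i \<longleftrightarrow> map_option tv (ow q') = pr i"
      if q': "q' \<in> Q" "tq q' = i" for q'
    proof (cases "ow q' = Some v")
      case True
      \<comment> \<open>A slot of \<open>v\<close> at another type \<open>i\<close> is no entry slot
        and does not become one: a new owner of type \<open>r'\<close> would need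
        \<open>pr i = Some r'\<close>, but the rank of \<open>i\<close> is at most that of
        \<open>r'\<close>.\<close>
      have Dir: "D i r"
        using typed[of q'] q' i True below[of i] by (auto simp: r_def)
      then obtain r' where r': "pr r = Some r'" "D i r'" using D_step[of i r] i by auto
      then have "pr i \<noteq> Some r'" using pr_rank[of i r'] D_rank_le[of i r'] by auto
      then have "map_option tv (ow q) \<noteq> pr i"
        using Qr_cases[of q] q r' below[OF i(1)] by (auto simp: EQr)
      then show ?thesis using True below[OF i(1)] by (auto simp: merge_owner_def r_def)
    qed (auto simp: merge_owner_def)
    moreover have "tq q \<noteq> i" using q i by (auto simp: Qr_def)
    ultimately show ?thesis by (auto simp: entry_slots_def)
  qed
  \<comment> \<open>The slot \<open>q\<close> is used up, while the slots in \<open>Dv\<close>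
    inherit its owner, or its lack of one, and join the entry slots.\<close>
  have E_entry: "card (entry_slots tv tq (merge_owner v q ow) (Q - {q}) r) = card (?E r) - 1 + card Dv"
    if q: "q \<in> ?E r" for q
  proof -
    have "entry_slots tv tq (merge_owner v q ow) (Q - {q}) r = (?E r - {q}) \<union> Dv"
      using q pr_r by (auto simp: entry_slots_def merge_owner_def Dv_def Qr_def r_def)
    moreover have "card ((?E r - {q}) \<union> Dv) = card (?E r - {q}) + card Dv"
      using disj finQr by (intro card_Un_disjoint) (auto simp: EQr Dv_def)
    ultimately show ?thesis using q finQr by (simp add: EQr)
  qed
  \<comment> \<open>The owner of \<open>q\<close> has type \<open>r\<close> itself, so neither
    \<open>q\<close> nor the slots in \<open>Dv\<close> are entry slots, before or after the
    merge.\<close>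
  have E_inner: "entry_slots tv tq (merge_owner v q ow) (Q - {q}) r = ?E r"
    if q: "q \<in> Qr - Dv - ?E r" for q
  proof -
    obtain u where "ow q = Some u" "tv u = r" using q Qr_cases[of q] by auto
    then show ?thesis
      using q pr_r by (auto simp: entry_slots_def merge_owner_def Dv_def Qr_def r_def)
  qed
  have split: "Qr - Dv = ?E r \<union> (Qr - Dv - ?E r)" using disj by (auto simp: EQr)
  have cardsplit: "card (Qr - Dv - ?E r) = card Qr - card (?E r) - card Dv"
  proof -
    have "card (Qr - Dv - ?E r) = card (Qr - Dv) - card (?E r)"
      using disj finQr by (intro card_Diff_subset) (auto simp: EQr)
    moreover have "card (Qr - Dv) = card Qr - card Dv"
      using finQr by (intro card_Diff_subset) (auto simp: Dv_def)
    ultimately show ?thesis by simp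
  qed
  have le: "card (?E r) + card Dv \<le> card Qr"
  proof -
    have "card (?E r) + card Dv = card (?E r \<union> Dv)"
      using disj finQr by (intro card_Un_disjoint[symmetric]) (auto simp: EQr Dv_def)
    also have "\<dots> \<le> card Qr" using finQr by (intro card_mono) (auto simp: EQr Dv_def)
    finally show ?thesis .
  qed
  have finmaps: "finite (slot_maps tv tq ow' ?W (Q - {q}))" for ow' q
    using finV by (auto simp: slot_maps_def intro!: finite_subset[OF _ finite_PiE[of ?W "\<lambda>_. Q - {q}"]])
  have sum: "card (slot_maps tv tq ow V Q) =
    (\<Sum>q\<in>Qr - Dv. card (slot_maps tv tq (merge_owner v q ow) ?W (Q - {q})))"
  proof -
    have eq: "{q \<in> Q. tq q = tv v \<and> ow q \<noteq> Some v} = Qr - Dv"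
      by (auto simp: Qr_def Dv_def r_def)
    have "card (slot_maps tv tq ow V Q) =
        card (SIGMA q : Qr - Dv. slot_maps tv tq (merge_owner v q ow) ?W (Q - {q}))"
      by (rule bij_betw_same_card[OF slot_maps_remove_vertex[of v V tv tq ow Q, unfolded eq]])
        (rule v)
    then show ?thesis using finQr finmaps by simp
  qed
  define P where "P = (\<Prod>i\<in>tv ` V - {r}. F i)"
  have prod_other: "(\<Prod>i\<in>tv ` V - {r}. card (entry_slots tv tq (merge_owner v q ow) (Q - {q}) i) *
       (fact (card {x \<in> ?W. tv x = i} - 1) *
         ((card {q' \<in> Q - {q}. tq q' = i} - 1) choose (card {x \<in> ?W. tv x = i} - 1)))) = P"
    if q: "q \<in> Qr - Dv" for q
    unfolding P_def F_def
  proof (rule prod.cong[OF refl])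
    fix i assume i: "i \<in> tv ` V - {r}"
    have "{x \<in> ?W. tv x = i} = {x \<in> V. tv x = i}" "{q' \<in> Q - {q}. tq q' = i} = {q' \<in> Q. tq q' = i}"
      using i q by (auto simp: r_def Qr_def)
    then show "card (entry_slots tv tq (merge_owner v q ow) (Q - {q}) i) *
       (fact (card {x \<in> ?W. tv x = i} - 1) *
         ((card {q' \<in> Q - {q}. tq q' = i} - 1) choose (card {x \<in> ?W. tv x = i} - 1)))
      = card (?E i) * (fact (card {x \<in> V. tv x = i} - 1) *
         ((card {q \<in> Q. tq q = i} - 1) choose (card {x \<in> V. tv x = i} - 1)))"
      using E_other[OF q] i by simp
  qed
  have total: "(\<Prod>i\<in>tv ` V. F i) = F r * P"
    unfolding P_def using v finV by (intro prod.remove) (auto simp: r_def)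
  let ?n = "card {x \<in> V. tv x = r}"
  have types_insert: "tv ` V = insert r (tv ` ?W)" using v by (auto simp: r_def)
  have "card (slot_maps tv tq ow V Q) = F r * P"
  proof (cases "r \<in> tv ` ?W")
    case True
    then obtain u where u: "u \<in> V" "u \<noteq> v" "tv u = r" by auto
    have "card {u, v} \<le> ?n" using u v finV by (intro card_mono) (auto simp: r_def)
    then have n2: "?n \<ge> 2" using u by auto
    have W: "card {x \<in> ?W. tv x = r} = ?n - 1"
    proof -
      have "{x \<in> ?W. tv x = r} = {x \<in> V. tv x = r} - {v}" by auto
      then show ?thesis using v finV by (simp add: r_def)
    qed
    have types: "tv ` ?W = tv ` V" using True types_insert by auto
    \<comment> \<open>Contraction leaves \<open>?n - 1\<close> vertices and
      \<open>card Qr - 1\<close> slots of type \<open>r\<close>; the induction hypothesis subtracts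
      one more from each.\<close>
    define B where "B = fact (?n - 2) * ((card Qr - 2) choose (?n - 2))"
    have each: "card (slot_maps tv tq (merge_owner v q ow) ?W (Q - {q})) =
      card (entry_slots tv tq (merge_owner v q ow) (Q - {q}) r) * B * P" if q: "q \<in> Qr - Dv" for q
    proof -
      have "{q' \<in> Q - {q}. tq q' = r} = Qr - {q}" by (auto simp: Qr_def)
      then have "card {q' \<in> Q - {q}. tq q' = r} = card Qr - 1" using q finQr by simp
      then show ?thesis
        unfolding IH[OF q] types B_def
        by (subst prod.remove[of _ r]) (use v finV prod_other[OF q] W in \<open>auto simp: r_def numeral_2_eq_2\<close>)
    qed
    have "card (slot_maps tv tq ow V Q) =
      (\<Sum>q\<in>Qr - Dv. card (entry_slots tv tq (merge_owner v q ow) (Q - {q}) r)) * B * P"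
      unfolding sum by (simp add: each sum_distrib_right)
    also have "(\<Sum>q\<in>Qr - Dv. card (entry_slots tv tq (merge_owner v q ow) (Q - {q}) r)) =
      (\<Sum>q\<in>?E r. card (entry_slots tv tq (merge_owner v q ow) (Q - {q}) r)) +
      (\<Sum>q\<in>Qr - Dv - ?E r. card (entry_slots tv tq (merge_owner v q ow) (Q - {q}) r))"
      by (subst split, rule sum.union_disjoint) (use finQr in \<open>auto simp: EQr\<close>)
    also have "\<dots> = card (?E r) * (card (?E r) - 1 + card Dv) +
      (card Qr - card (?E r) - card Dv) * card (?E r)"
      by (simp add: E_entry E_inner cardsplit)
    also have "\<dots> * B = F r"
      unfolding B_def using fact_binomial_step[OF n2 le] by (simp add: F_def Qr_def)
    finally show ?thesis .
  next
    case False
    have types: "tv ` ?W = tv ` V - {r}" using False types_insert by auto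
    have "tv x \<noteq> r" if "x \<in> ?W" for x using False imageI[OF that, of tv] by auto
    then have "{x \<in> V. tv x = r} = {v}" using v by (auto simp: r_def)
    then have n1: "?n = 1" by simp
    \<comment> \<open>No other vertex has type \<open>r\<close>, so every slot open to
      \<open>v\<close> is an entry slot. The type then drops out of the remaining product.\<close>
    have "Qr - Dv = ?E r"
    proof -
      have "q \<in> ?E r" if "q \<in> Qr - Dv" for q
        using Qr_cases[of q] that False by (auto simp: Dv_def image_iff)
      then show ?thesis using split by auto
    qed
    moreover have "card (slot_maps tv tq (merge_owner v q ow) ?W (Q - {q})) = P"
      if q: "q \<in> Qr - Dv" for q
      unfolding IH[OF q] types using prod_other[OF q] by simp
    ultimately have "card (slot_maps tv tq ow V Q) = card (?E r) * P"
      unfolding sum by simp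
    then show ?thesis by (simp add: F_def n1)
  qed
  then show ?case using total by (simp add: F_def)
qed

end

section \<open>Trees and parent functions\<close>

lemma is_path_rev: "is_path E u p v \<longleftrightarrow> is_path E v (rev p) u"
  by (auto simp: is_path_def hd_rev last_rev insert_commute)

lemma is_path_loop: "is_path E u p u \<longleftrightarrow> p = [u]"
  by (cases p) (auto simp: is_path_def)

lemma is_path_snoc:
  "p \<noteq> [] \<Longrightarrow> is_path E u (p @ [x]) v \<longleftrightarrow>
     v = x \<and> x \<notin> set p \<and> {last p, x} \<in> E \<and> is_path E u p (last p)"
  by (auto simp: is_path_def successively_append_iff)

lemma is_path_set:
  assumes "is_path E u p v" "u \<in> V" "\<And>a b. {a, b} \<in> E \<Longrightarrow> a \<in> V \<and> b \<in> V"
  shows "set p \<subseteq> V"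
  using assms(1)
proof (induction p arbitrary: v rule: rev_induct)
  case (snoc x p)
  show ?case
  proof (cases "p = []")
    case True
    then show ?thesis using snoc.prems assms(2) by (auto simp: is_path_def)
  next
    case False
    then show ?thesis using snoc assms(3) by (auto simp: is_path_snoc)
  qed
qed simp

lemma is_path_prefix:
  assumes "is_path E u (p @ q) v" "p \<noteq> []"
  shows "is_path E u p (last p)"
  using assms by (auto simp: is_path_def successively_append_iff)

lemma is_tree_edgeD:
  assumes "is_tree V E" "{a, b} \<in> E"
  shows "a \<in> V \<and> b \<in> V \<and> a \<noteq> b"
proof -
  have "{a, b} \<subseteq> V" "card {a, b} = 2" using assms by (auto simp: is_tree_def)
  then show ?thesis by (cases "a = b") auto
qed

lemma is_tree_singleton: "is_tree {v} {}"
  by (auto simp: is_tree_def is_path_loop)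

text \<open>A path between old vertices cannot visit \<open>x\<close>, since it would pass through
  \<open>y\<close> both before and after. Paths from old vertices to \<open>x\<close> are the paths
  to \<open>y\<close>, prolonged by \<open>x\<close>.\<close>

lemma is_tree_pendant:
  assumes tree: "is_tree V E" and y: "y \<in> V" and x: "x \<notin> V"
  shows "is_tree (insert x V) (insert {y, x} E)"
proof -
  let ?E = "insert {y, x} E"
  have EV: "\<And>a b. {a, b} \<in> E \<Longrightarrow> a \<in> V \<and> b \<in> V" using is_tree_edgeD[OF tree] by blast
  have xy: "y \<noteq> x" using x y by auto
  have nb: "a = y" if "{a, x} \<in> ?E \<or> {x, a} \<in> ?E" for a
    using that EV x xy by (auto simp: doubleton_eq_iff)
  have same: "is_path ?E u p v \<longleftrightarrow> is_path E u p v" if "x \<notin> set p" for u p v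
  proof -
    have "successively (\<lambda>a b. {a, b} \<in> ?E) p \<longleftrightarrow> successively (\<lambda>a b. {a, b} \<in> E) p"
      using that by (intro successively_cong) (auto simp: doubleton_eq_iff)
    then show ?thesis by (simp add: is_path_def)
  qed
  have inside: "is_path ?E u p v \<longleftrightarrow> is_path E u p v" if uv: "u \<in> V" "v \<in> V" for u p v
  proof
    assume p: "is_path ?E u p v"
    have "x \<notin> set p"
    proof
      assume "x \<in> set p"
      then obtain a b where ab: "p = a @ x # b" by (meson split_list)
      have a: "a \<noteq> []" and b: "b \<noteq> []" using p ab uv x by (auto simp: is_path_def)
      then have "last a = y" "hd b = y"
        using p ab nb by (auto simp: is_path_def successively_append_iff successively_Cons)
      then have "y \<in> set a \<inter> set b" using a b by (metis IntI hd_in_set last_in_set)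
      then show False using p ab by (auto simp: is_path_def)
    qed
    then show "is_path E u p v" using p same by auto
  next
    assume p: "is_path E u p v"
    then have "x \<notin> set p" using is_path_set[OF p uv(1) EV] x by auto
    then show "is_path ?E u p v" using p same by auto
  qed
  have outx: "is_path ?E u p x \<longleftrightarrow> (\<exists>p'. p = p' @ [x] \<and> is_path E u p' y)" if u: "u \<in> V" for u p
  proof
    assume p: "is_path ?E u p x"
    define p' where "p' = butlast p"
    have pp: "p = p' @ [x]" using p unfolding p'_def is_path_def by (metis append_butlast_last_id)
    have "p' \<noteq> []" using p pp u x by (auto simp: is_path_def)
    then have "{last p', x} \<in> ?E" "is_path ?E u p' (last p')" using p pp by (auto simp: is_path_snoc)
    moreover then have "last p' = y" using nb by auto
    ultimately show "\<exists>p'. p = p' @ [x] \<and> is_path E u p' y" using pp inside[OF u y] by auto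
  next
    assume "\<exists>p'. p = p' @ [x] \<and> is_path E u p' y"
    then obtain p' where p': "p = p' @ [x]" "is_path E u p' y" by auto
    then have "x \<notin> set p'" using is_path_set[OF p'(2) u EV] x by auto
    moreover have "last p' = y" "p' \<noteq> []" using p' by (auto simp: is_path_def)
    ultimately show "is_path ?E u p x" using p' inside[OF u y] by (auto simp: is_path_snoc)
  qed
  have ex1: "\<exists>!p. is_path E u p v" if "u \<in> V" "v \<in> V" for u v
    using tree that by (auto simp: is_tree_def)
  have to_x: "\<exists>!p. is_path ?E u p x" if "u \<in> V" for u
    using ex1[OF that y] unfolding outx[OF that] by blast
  have from_x: "\<exists>!p. is_path ?E x p u" if "u \<in> V" for u
    using to_x[OF that] by (metis is_path_rev rev_rev_ident)
  have "\<exists>!p. is_path ?E u p v" if uv: "u \<in> insert x V" "v \<in> insert x V" for u v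
  proof -
    consider "u = x" "v = x" | "u = x" "v \<in> V" | "u \<in> V" "v = x" | "u \<in> V" "v \<in> V"
      using uv by blast
    then show ?thesis
      by cases (use ex1 inside to_x from_x in \<open>simp_all add: is_path_loop\<close>)
  qed
  moreover have "?E \<subseteq> {e. e \<subseteq> insert x V \<and> card e = 2}"
    using tree y xy by (auto simp: is_tree_def)
  ultimately show ?thesis using y by (auto simp: is_tree_def)
qed

section \<open>From acyclic parent functions to trees\<close>

definition parent_rel :: "nat set \<Rightarrow> (nat \<Rightarrow> nat option) \<Rightarrow> (nat \<times> nat) set" where
  "parent_rel V \<pi> = {(v, u). v \<in> V \<and> \<pi> v = Some u}"

definition parent_edges :: "nat set \<Rightarrow> (nat \<Rightarrow> nat option) \<Rightarrow> nat set set" where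
  "parent_edges V \<pi> = {{u, v} | u v. v \<in> V \<and> \<pi> v = Some u}"

lemma finite_parent_rel: "finite V \<Longrightarrow> finite (parent_rel V \<pi>)"
  by (rule finite_subset[of _ "(\<lambda>v. (v, the (\<pi> v))) ` V"]) (auto simp: parent_rel_def image_iff)

lemma wf_parent_rel:
  assumes "finite V" "acyclic (parent_rel V \<pi>)"
  shows "wf (parent_rel V \<pi>)" "wf ((parent_rel V \<pi>)\<inverse>)"
  using assms finite_parent_rel by (auto intro: finite_acyclic_wf finite_acyclic_wf_converse)

text \<open>Induction on the number of vertices: a childless vertex is removed and then attached
  again as a pendant vertex.\<close>

lemma is_tree_parent_edges:
  assumes "finite V" "\<rho> \<in> V" "\<pi> \<rho> = None"
    and "\<And>v. v \<in> V \<Longrightarrow> v \<noteq> \<rho> \<Longrightarrow> \<exists>u\<in>V. \<pi> v = Some u"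
    and "acyclic (parent_rel V \<pi>)"
  shows "is_tree V (parent_edges V \<pi>)"
  using assms
proof (induction "card V" arbitrary: V)
  case (Suc m)
  show ?case
  proof (cases "V = {\<rho>}")
    case True
    then have "parent_edges V \<pi> = {}" using Suc.prems by (auto simp: parent_edges_def)
    then show ?thesis using True is_tree_singleton by simp
  next
    case False
    then obtain z where z: "z \<in> V - {\<rho>}" using Suc.prems by auto
    \<comment> \<open>In \<open>parent_rel\<close> a child precedes its parent, so a minimal
      non-root vertex has no non-root child. Nor is the root its child, as
      \<open>\<pi> \<rho> = None\<close>.\<close>
    obtain x where x: "x \<in> V - {\<rho>}" and leaf: "\<And>v. (v, x) \<in> parent_rel V \<pi> \<Longrightarrow> v \<notin> V - {\<rho>}"
      using wfE_min[OF wf_parent_rel(1) z] Suc.prems by metis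
    have leaf: "\<pi> v \<noteq> Some x" if "v \<in> V" for v
      using leaf[of v] that Suc.prems(3) by (auto simp: parent_rel_def)
    let ?W = "V - {x}"
    have tree: "is_tree ?W (parent_edges ?W \<pi>)"
    proof (rule Suc.hyps(1))
      show "m = card ?W" using Suc.hyps(2) x Suc.prems by auto
      show "\<exists>u\<in>?W. \<pi> v = Some u" if "v \<in> ?W" "v \<noteq> \<rho>" for v
        using Suc.prems(4)[of v] leaf[of v] that by auto
      show "acyclic (parent_rel ?W \<pi>)"
        by (rule acyclic_subset[OF Suc.prems(5)]) (auto simp: parent_rel_def)
    qed (use Suc.prems x in auto)
    obtain y where y: "y \<in> V" "\<pi> x = Some y" using Suc.prems(4) x by auto
    have "y \<noteq> x" using leaf[of x] x y by auto
    then have "is_tree (insert x ?W) (insert {y, x} (parent_edges ?W \<pi>))"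
      using y by (intro is_tree_pendant[OF tree]) auto
    moreover have "insert x ?W = V" using x by auto
    moreover have "parent_edges V \<pi> = parent_edges ?W \<pi> \<union> parent_edges {x} \<pi>"
      using x unfolding parent_edges_def by blast
    moreover have "parent_edges {x} \<pi> = {{y, x}}"
      using y by (auto simp: parent_edges_def)
    ultimately show ?thesis by simp
  qed
qed auto

text \<open>The path to the parent of \<open>v\<close> is prolonged by \<open>v\<close>, in a
  well-founded induction with parents as smaller elements. The bound by proper ancestors serves to
  keep \<open>v\<close> off the path to its parent, by acyclicity.\<close>

lemma parent_path:
  assumes fin: "finite V" and \<rho>: "\<rho> \<in> V" "\<pi> \<rho> = None"
    and par: "\<And>v. v \<in> V \<Longrightarrow> v \<noteq> \<rho> \<Longrightarrow> \<exists>u\<in>V. \<pi> v = Some u"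
    and ac: "acyclic (parent_rel V \<pi>)"
    and v: "v \<in> V"
  shows "\<exists>p. is_path (parent_edges V \<pi>) \<rho> (p @ [v]) v \<and> (\<forall>u. \<pi> v = Some u \<longrightarrow> p \<noteq> [] \<and> last p = u) \<and>
    set p \<subseteq> {x. (v, x) \<in> (parent_rel V \<pi>)\<^sup>+}"
  using wf_parent_rel(2)[OF fin ac] v
proof (induction v rule: wf_induct_rule)
  case (less v)
  show ?case
  proof (cases "v = \<rho>")
    case True
    then show ?thesis using \<rho> by (intro exI[of _ "[]"]) (auto simp: is_path_def)
  next
    case False
    then obtain u where u: "u \<in> V" "\<pi> v = Some u" using par less.prems by auto
    then have vu: "(v, u) \<in> parent_rel V \<pi>" using less.prems by (auto simp: parent_rel_def)
    then obtain p where p: "is_path (parent_edges V \<pi>) \<rho> (p @ [u]) u"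
      "set p \<subseteq> {x. (u, x) \<in> (parent_rel V \<pi>)\<^sup>+}"
      using less.IH[of u] u by auto
    have sub: "set (p @ [u]) \<subseteq> {x. (v, x) \<in> (parent_rel V \<pi>)\<^sup>+}"
      using p(2) vu by (auto intro: trancl_into_trancl2)
    then have "v \<notin> set (p @ [u])" using ac by (auto simp: acyclic_def)
    moreover have "{u, v} \<in> parent_edges V \<pi>" using u less.prems by (auto simp: parent_edges_def)
    ultimately have "is_path (parent_edges V \<pi>) \<rho> ((p @ [u]) @ [v]) v"
      using p(1) by (subst is_path_snoc) auto
    then show ?thesis using sub u by (intro exI[of _ "p @ [u]"]) auto
  qed
qed

section \<open>From rooted trees to parent functions\<close>

definition parent_of :: "emb_tree \<Rightarrow> nat \<Rightarrow> nat option" where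
  "parent_of T = (\<lambda>v\<in>verts T. if \<exists>w. is_parent T w v then Some (THE w. is_parent T w v) else None)"

context
  fixes T assumes T: "rooted_Cayley_tree T"
begin

lemma rooted_Cayley_is_tree: "is_tree (verts T) (edges T)" and root_in_verts: "root T \<in> verts T"
  using T by (auto simp: rooted_Cayley_tree_def)

lemma edge_verts: "{a, b} \<in> edges T \<Longrightarrow> a \<in> verts T \<and> b \<in> verts T"
  using is_tree_edgeD[OF rooted_Cayley_is_tree] by blast

lemma root_path_unique:
  assumes "is_path (edges T) (root T) p v" "is_path (edges T) (root T) q v"
  shows "p = q"
proof -
  have "set p \<subseteq> verts T" by (rule is_path_set[OF assms(1) root_in_verts edge_verts])
  moreover have "v \<in> set p" using assms(1) by (auto simp: is_path_def)
  ultimately show ?thesis using rooted_Cayley_is_tree assms root_in_verts unfolding is_tree_def by blast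
qed

lemma is_parent_unique: "is_parent T w v \<Longrightarrow> is_parent T w' v \<Longrightarrow> w = w'"
  using root_path_unique by (fastforce simp: is_parent_def)

lemma is_parent_edge:
  assumes "is_parent T w v"
  shows "{w, v} \<in> edges T"
  using assms by (auto simp: is_parent_def is_path_def successively_append_iff)

lemma is_parent_verts: "is_parent T w v \<Longrightarrow> w \<in> verts T \<and> v \<in> verts T"
  using is_parent_edge edge_verts by blast

lemma root_no_parent: "\<not> is_parent T w (root T)"
  by (auto simp: is_parent_def is_path_loop)

lemma parent_exists:
  assumes "v \<in> verts T" "v \<noteq> root T"
  shows "\<exists>w. is_parent T w v"
proof -
  obtain p where p: "is_path (edges T) (root T) p v"
    using rooted_Cayley_is_tree assms root_in_verts unfolding is_tree_def by blast
  obtain q where q: "p = q @ [v]" using p unfolding is_path_def by (metis append_butlast_last_id)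
  then have "q \<noteq> []" using p assms by (auto simp: is_path_def)
  then obtain q' w where "q = q' @ [w]" by (metis append_butlast_last_id)
  then show ?thesis using p q by (auto simp: is_parent_def)
qed

lemma is_parent_iff: "is_parent T w v \<longleftrightarrow> v \<in> verts T \<and> parent_of T v = Some w"
proof -
  have "(THE w. is_parent T w v) = w" if "is_parent T w v" for w
    using that is_parent_unique by blast
  then show ?thesis using is_parent_verts by (auto simp: parent_of_def)
qed

lemma parent_of_None_iff: "v \<in> verts T \<Longrightarrow> parent_of T v = None \<longleftrightarrow> v = root T"
  using parent_exists root_no_parent by (auto simp: parent_of_def)

text \<open>For an edge \<open>{x, y}\<close>, consider the path from the root to \<open>x\<close>.
  If it avoids \<open>y\<close>, it extends to \<open>y\<close>, and \<open>x\<close> is the parent.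
  Otherwise its part up to \<open>y\<close> avoids \<open>x\<close> and extends to \<open>x\<close>,
  and \<open>y\<close> is the parent.\<close>

lemma edges_eq_parent_edges: "edges T = parent_edges (verts T) (parent_of T)"
proof
  show "parent_edges (verts T) (parent_of T) \<subseteq> edges T"
    using is_parent_edge is_parent_iff by (auto simp: parent_edges_def)
  show "edges T \<subseteq> parent_edges (verts T) (parent_of T)"
  proof
    fix e assume e: "e \<in> edges T"
    then have "card e = 2" using rooted_Cayley_is_tree by (auto simp: is_tree_def)
    then obtain x y where xy: "e = {x, y}" "x \<noteq> y" by (meson card_2_iff)
    have V: "x \<in> verts T" "y \<in> verts T" using edge_verts e xy by auto
    then obtain p where p: "is_path (edges T) (root T) p x"
      using rooted_Cayley_is_tree root_in_verts unfolding is_tree_def by blast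
    then have pl: "last p = x" "p \<noteq> []" by (auto simp: is_path_def)
    have "is_parent T x y \<or> is_parent T y x"
    proof (cases "y \<in> set p")
      case False
      then have "is_path (edges T) (root T) (p @ [y]) y"
        using p pl e xy by (simp add: is_path_snoc)
      moreover obtain q where "p = q @ [x]" using pl by (metis append_butlast_last_id)
      ultimately show ?thesis by (auto simp: is_parent_def)
    next
      case True
      then obtain a b where ab: "p = a @ y # b" by (meson split_list)
      then have "b \<noteq> []" using pl xy by auto
      then have "x \<in> set b" using pl ab by auto
      then have "x \<notin> set (a @ [y])" using p ab by (auto simp: is_path_def)
      moreover have "is_path (edges T) (root T) (a @ [y]) y"
        using is_path_prefix[of "edges T" "root T" "a @ [y]" b x] p ab by simp
      ultimately have "is_path (edges T) (root T) ((a @ [y]) @ [x]) x"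
        using e xy by (subst is_path_snoc) (auto simp: insert_commute)
      then show ?thesis by (auto simp: is_parent_def)
    qed
    then show "e \<in> parent_edges (verts T) (parent_of T)"
      using xy is_parent_iff by (auto simp: parent_edges_def insert_commute)
  qed
qed

text \<open>The path from the root to a child is longer than the one to its parent; \<open>d\<close>
  measures this length.\<close>

lemma acyclic_parent_of: "acyclic (parent_rel (verts T) (parent_of T))"
proof -
  define d where "d v = length (THE p. is_path (edges T) (root T) p v)" for v
  have d: "d v = length p" if "is_path (edges T) (root T) p v" for v p
  proof -
    have "(THE p. is_path (edges T) (root T) p v) = p"
      using that root_path_unique by (intro the_equality) auto
    then show ?thesis by (simp add: d_def)
  qed
  have "d u < d v" if vu: "(v, u) \<in> parent_rel (verts T) (parent_of T)" for u v
  proof -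
    have "is_parent T u v" using vu is_parent_iff by (auto simp: parent_rel_def)
    then obtain p where p: "is_path (edges T) (root T) (p @ [u, v]) v" by (auto simp: is_parent_def)
    then have "is_path (edges T) (root T) (p @ [u]) u"
      using is_path_prefix[of "edges T" "root T" "p @ [u]" "[v]" v] by simp
    then show ?thesis using d p by fastforce
  qed
  then have "(parent_rel (verts T) (parent_of T))\<inverse> \<subseteq> measure d" by auto
  then have "wf ((parent_rel (verts T) (parent_of T))\<inverse>)" using wf_subset by blast
  then show ?thesis by (metis acyclic_converse wf_acyclic)
qed

end

section \<open>Injective embedded trees as parent functions\<close>

text \<open>Injectivity of \<open>(\<pi> v, a v)\<close> does double duty. At a parent
  \<open>Some u\<close> it allows one child per abscissa; at \<open>None\<close>, where the abscissa
  is always \<open>0\<close>, it allows only one root.\<close>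

definition parent_funs :: "int set \<Rightarrow> nat set \<Rightarrow> (nat \<Rightarrow> int) \<Rightarrow> (nat \<Rightarrow> nat option) set" where
  "parent_funs S V a = {\<pi> \<in> extensional V.
     (\<forall>v\<in>V. case \<pi> v of None \<Rightarrow> a v = 0 | Some u \<Rightarrow> u \<in> V \<and> a v - a u \<in> S) \<and>
     inj_on (\<lambda>v. (\<pi> v, a v)) V \<and> acyclic (parent_rel V \<pi>)}"

definition tree_of :: "nat \<Rightarrow> (nat \<Rightarrow> int) \<Rightarrow> (nat \<Rightarrow> nat option) \<Rightarrow> emb_tree" where
  "tree_of m a \<pi> = \<lparr>tsize = m, edges = parent_edges {1..m} \<pi>,
     root = (THE v. v \<in> {1..m} \<and> \<pi> v = None), absc = a\<rparr>"

lemma tree_of_simps [simp]: "tsize (tree_of m a \<pi>) = m" "absc (tree_of m a \<pi>) = a"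
  by (simp_all add: tree_of_def)

lemma parent_funsD:
  assumes "\<pi> \<in> parent_funs S V a" "v \<in> V"
  shows "\<pi> v = None \<Longrightarrow> a v = 0" "\<pi> v = Some u \<Longrightarrow> u \<in> V" "\<pi> v = Some u \<Longrightarrow> a v - a u \<in> S"
  using assms by (auto simp: parent_funs_def split: option.splits)

lemma parent_funs_injD:
  assumes "\<pi> \<in> parent_funs S V a" "u \<in> V" "v \<in> V" "\<pi> u = \<pi> v" "a u = a v"
  shows "u = v"
  using assms by (auto simp: parent_funs_def inj_on_def)

lemma finite_verts: "finite (verts T)"
  by (simp add: verts_def)

lemma parent_of_in_parent_funs:
  assumes T: "T \<in> injective_S_embedded S"
  shows "parent_of T \<in> parent_funs S (verts T) (absc T)"
proof -
  have rct: "rooted_Cayley_tree T" and root0: "absc T (root T) = 0"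
    and step: "\<And>v w. v \<in> verts T \<Longrightarrow> w \<in> verts T \<Longrightarrow> is_parent T v w \<Longrightarrow> absc T w - absc T v \<in> S"
    and inj: "\<And>v s. v \<in> verts T \<Longrightarrow> s \<in> S \<Longrightarrow>
      card {w \<in> verts T. is_parent T v w \<and> absc T w = absc T v + s} \<le> 1"
    using T by (auto simp: injective_S_embedded_def S_embedded_def)
  note par = is_parent_iff[OF rct] and no_parent = parent_of_None_iff[OF rct] and vs = is_parent_verts[OF rct]
  have "inj_on (\<lambda>v. (parent_of T v, absc T v)) (verts T)"
  proof (rule inj_onI, clarify)
    fix x y assume xy: "x \<in> verts T" "y \<in> verts T" "parent_of T x = parent_of T y" "absc T x = absc T y"
    show "x = y"
    proof (cases "parent_of T x")
      case None
      then show ?thesis using xy no_parent by metis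
    next
      case (Some u)
      let ?A = "{w \<in> verts T. is_parent T u w \<and> absc T w = absc T u + (absc T x - absc T u)}"
      have u: "is_parent T u x" "is_parent T u y" using par xy Some by auto
      then have "card ?A \<le> Suc 0" using inj[of u "absc T x - absc T u"] step vs by auto
      moreover have "x \<in> ?A" "y \<in> ?A" using u xy by auto
      moreover have "finite ?A" using finite_verts by auto
      ultimately show ?thesis by (meson card_le_Suc0_iff_eq)
    qed
  qed
  moreover have "parent_of T \<in> extensional (verts T)" by (simp add: parent_of_def)
  moreover have "case parent_of T v of None \<Rightarrow> absc T v = 0
      | Some u \<Rightarrow> u \<in> verts T \<and> absc T v - absc T u \<in> S" if v: "v \<in> verts T" for v
  proof (cases "parent_of T v")
    case (Some u)
    then have "is_parent T u v" using par v by simp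
    then show ?thesis using Some step[of u v] vs[of u v] by simp
  qed (use no_parent[OF v] root0 in simp)
  ultimately show ?thesis
    using acyclic_parent_of[OF rct] by (simp add: parent_funs_def)
qed

text \<open>Existence comes from a vertex that is minimal when parents count as smaller; uniqueness
  is the injectivity condition at \<open>None\<close>.\<close>

lemma parent_funs_root:
  assumes \<pi>: "\<pi> \<in> parent_funs S V a" and V: "finite V" "V \<noteq> {}"
  shows "\<exists>!v. v \<in> V \<and> \<pi> v = None"
proof (rule ex_ex1I)
  have "acyclic (parent_rel V \<pi>)" using \<pi> by (auto simp: parent_funs_def)
  then have wf: "wf ((parent_rel V \<pi>)\<inverse>)" using wf_parent_rel V by auto
  obtain x where "x \<in> V" using V by auto
  then obtain z where z: "z \<in> V" "\<And>y. (y, z) \<in> (parent_rel V \<pi>)\<inverse> \<Longrightarrow> y \<notin> V"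
    using wfE_min[OF wf] by metis
  have "\<pi> z = None"
  proof (cases "\<pi> z")
    case (Some u)
    then have "(u, z) \<in> (parent_rel V \<pi>)\<inverse>" using z(1) by (simp add: parent_rel_def)
    then show ?thesis using z(2) parent_funsD(2)[OF \<pi> z(1) Some] by blast
  qed
  then show "\<exists>v. v \<in> V \<and> \<pi> v = None" using z(1) by blast
  show "x = y" if "x \<in> V \<and> \<pi> x = None" "y \<in> V \<and> \<pi> y = None" for x y
    using parent_funs_injD[OF \<pi>, of x y] parent_funsD(1)[OF \<pi>] that by auto
qed

text \<open>The root path given by \<open>parent_path\<close> visits the value of
  \<open>\<pi>\<close> just before \<open>v\<close> and so witnesses \<open>is_parent\<close>.
  Together with \<open>tree_of_parent_of\<close>, this makes \<open>tree_of\<close> and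
  \<open>parent_of\<close> mutually inverse.\<close>

lemma tree_of_parent_fun:
  assumes \<pi>: "\<pi> \<in> parent_funs S {1..m} a" and a: "a \<in> extensional {1..m}" and m: "m \<ge> 1"
  shows "tree_of m a \<pi> \<in> injective_S_embedded S" "parent_of (tree_of m a \<pi>) = \<pi>"
proof -
  let ?V = "{1..m}" and ?T = "tree_of m a \<pi>"
  have verts: "verts ?T = ?V" and edges: "edges ?T = parent_edges ?V \<pi>" and absc: "absc ?T = a"
    by (auto simp: tree_of_def verts_def)
  define \<rho> where "\<rho> = root ?T"
  have ex1: "\<exists>!v. v \<in> ?V \<and> \<pi> v = None" using parent_funs_root[OF \<pi>] m by auto
  then have \<rho>: "\<rho> \<in> ?V" "\<pi> \<rho> = None"
    using theI'[OF ex1] by (auto simp: \<rho>_def tree_of_def)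
  have par: "\<exists>u\<in>?V. \<pi> v = Some u" if "v \<in> ?V" "v \<noteq> \<rho>" for v
    using ex1 \<rho> that parent_funsD(2)[OF \<pi> that(1)] by (cases "\<pi> v") auto
  have ac: "acyclic (parent_rel ?V \<pi>)" using \<pi> by (auto simp: parent_funs_def)
  have rct: "rooted_Cayley_tree ?T"
    using is_tree_parent_edges[OF _ \<rho> par ac] \<rho> verts edges by (auto simp: rooted_Cayley_tree_def \<rho>_def)
  have ext: "parent_of ?T \<in> extensional ?V" "\<pi> \<in> extensional ?V"
    using \<pi> verts by (auto simp: parent_funs_def parent_of_def)
  have "parent_of ?T v = \<pi> v" if v: "v \<in> ?V" for v
  proof (cases "\<pi> v")
    case None
    then have "v = \<rho>" using ex1 \<rho> v by auto
    then show ?thesis using parent_of_None_iff[OF rct, of v] None v verts by (auto simp: \<rho>_def)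
  next
    case (Some u)
    obtain p where p: "is_path (parent_edges ?V \<pi>) \<rho> (p @ [v]) v" "p \<noteq> []" "last p = u"
      using parent_path[OF _ \<rho> par ac v] Some by auto
    then obtain q where "p = q @ [u]" by (metis append_butlast_last_id)
    then have "is_parent ?T u v" using p edges by (auto simp: is_parent_def \<rho>_def)
    then show ?thesis using is_parent_iff[OF rct] Some by auto
  qed
  then show eq: "parent_of ?T = \<pi>" using ext by (intro extensionalityI[of _ ?V]) auto
  have iff: "is_parent ?T w v \<longleftrightarrow> v \<in> ?V \<and> \<pi> v = Some w" for w v
    using is_parent_iff[OF rct] eq verts by auto
  have "?T \<in> S_embedded S"
    unfolding S_embedded_def mem_Collect_eq verts absc \<rho>_def[symmetric]
    using rct a \<rho> parent_funsD(1)[OF \<pi> \<rho>(1)] parent_funsD(3)[OF \<pi>] iff by simp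
  moreover have "card {w \<in> ?V. is_parent ?T v w \<and> a w = a v + s} \<le> Suc 0" for v s
    by (subst card_le_Suc0_iff_eq) (auto simp: iff intro!: parent_funs_injD[OF \<pi>])
  ultimately show "?T \<in> injective_S_embedded S"
    using verts absc by (auto simp: injective_S_embedded_def)
qed

lemma tree_of_parent_of:
  assumes "rooted_Cayley_tree T"
  shows "tree_of (tsize T) (absc T) (parent_of T) = T"
proof -
  have "(THE v. v \<in> verts T \<and> parent_of T v = None) = root T"
    using parent_of_None_iff[OF assms] root_in_verts[OF assms] by (intro the_equality) auto
  then show ?thesis
    using edges_eq_parent_edges[OF assms] by (intro emb_tree.equality) (auto simp: tree_of_def verts_def)
qed

text \<open>All conditions are pulled back to \<open>V\<close>. For acyclicity, the converse of the
  new relation lies in the inverse image of a well-founded one under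
  \<open>inv_into V \<sigma>\<close>.\<close>

lemma parent_funs_transport:
  assumes \<pi>: "\<pi> \<in> parent_funs S V a" and \<sigma>: "bij_betw \<sigma> V V'"
    and a: "\<And>v. v \<in> V \<Longrightarrow> a' (\<sigma> v) = a v"
    and \<pi>': "\<pi>' \<in> extensional V'" "\<And>v. v \<in> V \<Longrightarrow> \<pi>' (\<sigma> v) = map_option \<sigma> (\<pi> v)"
    and fin: "finite V"
  shows "\<pi>' \<in> parent_funs S V' a'"
proof -
  have V': "V' = \<sigma> ` V" and inj: "inj_on \<sigma> V" using \<sigma> by (auto simp: bij_betw_def)
  have eq: "u = v" if "u \<in> V" "v \<in> V" "map_option \<sigma> (\<pi> u) = map_option \<sigma> (\<pi> v)" "a u = a v" for u v
  proof -
    have "\<pi> u = \<pi> v"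
    proof (rule option.inj_map_strong[OF _ that(3)])
      fix x y assume "x \<in> set_option (\<pi> u)" "y \<in> set_option (\<pi> v)" "\<sigma> x = \<sigma> y"
      moreover then have "x \<in> V" "y \<in> V"
        using parent_funsD(2)[OF \<pi>] that(1,2) by (metis elem_set)+
      ultimately show "x = y" using inj by (simp add: inj_on_eq_iff)
    qed
    then show ?thesis using parent_funs_injD[OF \<pi>] that by auto
  qed
  have "inj_on (\<lambda>v. (\<pi>' v, a' v)) V'"
    by (rule inj_onI) (auto simp: V' \<pi>' a intro: arg_cong[OF eq])
  moreover have "acyclic (parent_rel V' \<pi>')"
  proof -
    have "wf ((parent_rel V \<pi>)\<inverse>)"
      using wf_parent_rel[OF fin] \<pi> by (auto simp: parent_funs_def)
    then have "wf (inv_image ((parent_rel V \<pi>)\<inverse>) (inv_into V \<sigma>))" by (rule wf_inv_image)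
    moreover have "(parent_rel V' \<pi>')\<inverse> \<subseteq> inv_image ((parent_rel V \<pi>)\<inverse>) (inv_into V \<sigma>)"
    proof clarify
      fix v u assume "(v, u) \<in> parent_rel V' \<pi>'"
      then obtain x y where x: "x \<in> V" "v = \<sigma> x" and y: "\<pi> x = Some y" "u = \<sigma> y"
        by (auto simp: parent_rel_def V' \<pi>')
      then have "y \<in> V" using parent_funsD(2)[OF \<pi>] by blast
      then show "(u, v) \<in> inv_image ((parent_rel V \<pi>)\<inverse>) (inv_into V \<sigma>)"
        using x y inj by (simp add: parent_rel_def)
    qed
    ultimately have "wf ((parent_rel V' \<pi>')\<inverse>)" by (rule wf_subset)
    then show ?thesis by (metis acyclic_converse wf_acyclic)
  qed
  moreover have "case \<pi>' v of None \<Rightarrow> a' v = 0 | Some u \<Rightarrow> u \<in> V' \<and> a' v - a' u \<in> S" if v: "v \<in> V'" for v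
  proof -
    obtain x where x: "x \<in> V" "v = \<sigma> x" using v V' by auto
    show ?thesis
    proof (cases "\<pi> x")
      case None
      then show ?thesis using x \<pi>'(2) parent_funsD(1)[OF \<pi> x(1)] a by simp
    next
      case (Some y)
      then show ?thesis using x \<pi>'(2) parent_funsD(2,3)[OF \<pi> x(1) Some] a V' by simp
    qed
  qed
  ultimately show ?thesis using \<pi>' by (auto simp: parent_funs_def)
qed

text \<open>A vertex is determined by its parent and its abscissa, so an isomorphism is determined
  from the root downwards. Hence trees have no nontrivial automorphism.\<close>

lemma parent_funs_rigid:
  assumes \<pi>: "\<pi> \<in> parent_funs S V a" and \<pi>': "\<pi>' \<in> parent_funs S' V' a'" and fin: "finite V"
    and \<sigma>: "\<And>v. v \<in> V \<Longrightarrow> \<sigma> v \<in> V' \<and> a' (\<sigma> v) = a v \<and> \<pi>' (\<sigma> v) = map_option \<sigma> (\<pi> v)"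
    and \<tau>: "\<And>v. v \<in> V \<Longrightarrow> \<tau> v \<in> V' \<and> a' (\<tau> v) = a v \<and> \<pi>' (\<tau> v) = map_option \<tau> (\<pi> v)"
    and v: "v \<in> V"
  shows "\<sigma> v = \<tau> v"
proof -
  have "wf ((parent_rel V \<pi>)\<inverse>)" using wf_parent_rel[OF fin] \<pi> by (auto simp: parent_funs_def)
  then show ?thesis
    using v
  proof (induction v rule: wf_induct_rule)
    case (less v)
    have "map_option \<sigma> (\<pi> v) = map_option \<tau> (\<pi> v)"
    proof (cases "\<pi> v")
      case (Some u)
      then have "u \<in> V" "(u, v) \<in> (parent_rel V \<pi>)\<inverse>"
        using parent_funsD(2)[OF \<pi> less.prems] less.prems by (auto simp: parent_rel_def)
      then show ?thesis using less.IH Some by auto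
    qed simp
    then show ?case using parent_funs_injD[OF \<pi>', of "\<sigma> v" "\<tau> v"] \<sigma>[OF less.prems] \<tau>[OF less.prems] by simp
  qed
qed

section \<open>Isomorphism classes\<close>

text \<open>The relational condition becomes commutation of \<open>f\<close> with the parent
  functions. Surjectivity of \<open>f\<close> ensures that a parentless vertex has a parentless
  image; injectivity lets a parent be recovered from its image.\<close>

lemma emb_equiv_iff:
  assumes "T \<in> S_embedded S" "T' \<in> S_embedded S"
  shows "(T, T') \<in> emb_equiv S \<longleftrightarrow> tsize T = tsize T' \<and>
    (\<exists>f. bij_betw f (verts T) (verts T') \<and> (\<forall>v\<in>verts T. absc T' (f v) = absc T v) \<and>
      (\<forall>v\<in>verts T. parent_of T' (f v) = map_option f (parent_of T v)))"
proof -
  have rct: "rooted_Cayley_tree T" "rooted_Cayley_tree T'" using assms by (auto simp: S_embedded_def)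
  note iff = is_parent_iff[OF rct(1)] is_parent_iff[OF rct(2)]
  note vs = is_parent_verts[OF rct(1)] is_parent_verts[OF rct(2)]
  have "(\<forall>v\<in>verts T. \<forall>w\<in>verts T. is_parent T w v \<longleftrightarrow> is_parent T' (f w) (f v)) \<longleftrightarrow>
      (\<forall>v\<in>verts T. parent_of T' (f v) = map_option f (parent_of T v))"
    (is "?L \<longleftrightarrow> ?R") if f: "bij_betw f (verts T) (verts T')" for f
  proof
    assume L: ?L
    show ?R
    proof
      fix v assume v: "v \<in> verts T"
      then have fv: "f v \<in> verts T'" using f by (auto simp: bij_betw_def)
      show "parent_of T' (f v) = map_option f (parent_of T v)"
      proof (cases "parent_of T v")
        case (Some w)
        then have "is_parent T w v" using iff v by auto
        then have "is_parent T' (f w) (f v)" using L vs by blast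
        then show ?thesis using iff Some by auto
      next
        case None
        have "parent_of T' (f v) = None"
        proof (cases "parent_of T' (f v)")
          case (Some w')
          then have p: "is_parent T' w' (f v)" using iff fv by auto
          then have "w' \<in> f ` verts T" using vs f by (auto simp: bij_betw_def)
          then obtain w where "w \<in> verts T" "w' = f w" by auto
          then have "is_parent T w v" using L p v by blast
          then show ?thesis using iff None by auto
        qed
        then show ?thesis using None by simp
      qed
    qed
  next
    assume R: ?R
    show ?L
    proof (intro ballI)
      fix v w assume vw: "v \<in> verts T" "w \<in> verts T"
      have fv: "f v \<in> verts T'" using f vw by (auto simp: bij_betw_def)
      have "is_parent T' (f w) (f v) \<longleftrightarrow> map_option f (parent_of T v) = Some (f w)"
        using iff fv R vw by auto
      also have "\<dots> \<longleftrightarrow> parent_of T v = Some w"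
      proof -
        have "u = w" if "parent_of T v = Some u" "f u = f w" for u
        proof -
          have "u \<in> verts T" using that iff vs vw by blast
          then show ?thesis using that f vw by (auto simp: bij_betw_def inj_on_def)
        qed
        then show ?thesis by auto
      qed
      finally show "is_parent T w v \<longleftrightarrow> is_parent T' (f w) (f v)" using iff vw by auto
    qed
  qed
  then show ?thesis using assms unfolding emb_equiv_def by blast
qed

lemma equiv_emb_equiv: "equiv (S_embedded S) (emb_equiv S)"
proof (rule equivI)
  show "emb_equiv S \<subseteq> S_embedded S \<times> S_embedded S" by (auto simp: emb_equiv_def)
  show "refl_on (S_embedded S) (emb_equiv S)"
    by (auto simp: refl_on_def emb_equiv_def intro!: exI[of _ id])
  show "sym (emb_equiv S)"
  proof (rule symI)
    fix T T' assume "(T, T') \<in> emb_equiv S"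
    then obtain f where TT: "T \<in> S_embedded S" "T' \<in> S_embedded S" "tsize T = tsize T'"
      and f: "bij_betw f (verts T) (verts T')"
        "\<And>v w. v \<in> verts T \<Longrightarrow> w \<in> verts T \<Longrightarrow> is_parent T w v \<longleftrightarrow> is_parent T' (f w) (f v)"
        "\<And>v. v \<in> verts T \<Longrightarrow> absc T' (f v) = absc T v"
      by (auto simp: emb_equiv_def)
    let ?g = "inv_into (verts T) f"
    have g: "bij_betw ?g (verts T') (verts T)" by (rule bij_betw_inv_into[OF f(1)])
    have "?g v \<in> verts T" "f (?g v) = v" if "v \<in> verts T'" for v
      using that bij_betw_apply[OF g] bij_betw_inv_into_right[OF f(1)] by auto
    then show "(T', T) \<in> emb_equiv S"
      using TT g f(2,3) unfolding emb_equiv_def by (auto intro!: exI[of _ ?g]) (metis)+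
  qed
  show "trans (emb_equiv S)"
  proof (rule transI)
    fix T T' T'' assume "(T, T') \<in> emb_equiv S" "(T', T'') \<in> emb_equiv S"
    then obtain f g where TT: "T \<in> S_embedded S" "T'' \<in> S_embedded S" "tsize T = tsize T''"
      and f: "bij_betw f (verts T) (verts T')"
        "\<And>v w. v \<in> verts T \<Longrightarrow> w \<in> verts T \<Longrightarrow> is_parent T w v \<longleftrightarrow> is_parent T' (f w) (f v)"
        "\<And>v. v \<in> verts T \<Longrightarrow> absc T' (f v) = absc T v"
      and g: "bij_betw g (verts T') (verts T'')"
        "\<And>v w. v \<in> verts T' \<Longrightarrow> w \<in> verts T' \<Longrightarrow> is_parent T' w v \<longleftrightarrow> is_parent T'' (g w) (g v)"
        "\<And>v. v \<in> verts T' \<Longrightarrow> absc T'' (g v) = absc T' v"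
      by (auto simp: emb_equiv_def)
    then show "(T, T'') \<in> emb_equiv S"
      using bij_betw_trans[OF f(1) g(1)] bij_betw_apply[OF f(1)]
      by (auto simp: emb_equiv_def intro!: exI[of _ "g \<circ> f"])
  qed
qed

text \<open>The equivalence lives on all embedded trees, but only classes of injective ones are
  counted; any representative of such a class may therefore be treated as injective.\<close>

lemma injective_S_embedded_equiv:
  assumes T: "T \<in> injective_S_embedded S" and TT: "(T, T') \<in> emb_equiv S"
  shows "T' \<in> injective_S_embedded S"
proof -
  have emb: "T \<in> S_embedded S" "T' \<in> S_embedded S" using TT by (auto simp: emb_equiv_def)
  have rct: "rooted_Cayley_tree T'" and ext: "absc T' \<in> extensional (verts T')"
    using emb by (auto simp: S_embedded_def)
  obtain f where f: "bij_betw f (verts T) (verts T')" "\<And>v. v \<in> verts T \<Longrightarrow> absc T' (f v) = absc T v"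
      "\<And>v. v \<in> verts T \<Longrightarrow> parent_of T' (f v) = map_option f (parent_of T v)"
    using TT emb_equiv_iff[OF emb] by auto
  have ext': "parent_of T' \<in> extensional (verts T')" by (simp add: parent_of_def)
  have "parent_of T' \<in> parent_funs S (verts T') (absc T')"
    by (rule parent_funs_transport[OF parent_of_in_parent_funs[OF T] f(1,2) ext' f(3) finite_verts])
  moreover have "tsize T' \<ge> 1" using root_in_verts[OF rct] by (auto simp: verts_def)
  ultimately show ?thesis
    using tree_of_parent_fun(1)[of "parent_of T'" S "tsize T'" "absc T'"] ext tree_of_parent_of[OF rct]
    by (auto simp: verts_def)
qed

section \<open>Relabelling vertices\<close>

definition relabel :: "nat set \<Rightarrow> nat set \<Rightarrow> (nat \<Rightarrow> nat) \<Rightarrow> (nat \<Rightarrow> nat option) \<Rightarrow> nat \<Rightarrow> nat option" where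
  "relabel V V' \<sigma> \<pi> = (\<lambda>v\<in>V'. map_option \<sigma> (\<pi> (inv_into V \<sigma> v)))"

lemma relabel_apply:
  assumes "bij_betw \<sigma> V V'" "v \<in> V"
  shows "relabel V V' \<sigma> \<pi> (\<sigma> v) = map_option \<sigma> (\<pi> v)"
  using assms by (auto simp: relabel_def bij_betw_def)

lemma relabel_tree:
  assumes T: "T \<in> injective_S_embedded S" and \<sigma>: "bij_betw \<sigma> (verts T) {1..tsize T}"
    and a: "a \<in> extensional {1..tsize T}" "\<And>v. v \<in> verts T \<Longrightarrow> a (\<sigma> v) = absc T v"
  defines "T' \<equiv> tree_of (tsize T) a (relabel (verts T) {1..tsize T} \<sigma> (parent_of T))"
  shows "T' \<in> injective_S_embedded S" "(T, T') \<in> emb_equiv S"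
    "parent_of T' = relabel (verts T) {1..tsize T} \<sigma> (parent_of T)"
proof -
  let ?\<pi> = "relabel (verts T) {1..tsize T} \<sigma> (parent_of T)"
  have emb: "T \<in> S_embedded S" using T by (auto simp: injective_S_embedded_def)
  then have "rooted_Cayley_tree T" by (auto simp: S_embedded_def)
  then have m: "tsize T \<ge> 1" using root_in_verts by (fastforce simp: verts_def)
  have "?\<pi> \<in> extensional {1..tsize T}" unfolding relabel_def by (rule restrict_extensional)
  then have "?\<pi> \<in> parent_funs S {1..tsize T} a"
    by (intro parent_funs_transport[OF parent_of_in_parent_funs[OF T] \<sigma>] a(2) relabel_apply[OF \<sigma>] finite_verts)
  from tree_of_parent_fun[OF this a(1) m]
  show T': "T' \<in> injective_S_embedded S" and par: "parent_of T' = ?\<pi>" by (auto simp: T'_def)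
  have "T' \<in> S_embedded S" using T' by (auto simp: injective_S_embedded_def)
  moreover have "tsize T' = tsize T" "absc T' = a" by (auto simp: T'_def tree_of_def)
  moreover have "verts T' = {1..tsize T}" by (auto simp: T'_def tree_of_def verts_def)
  ultimately show "(T, T') \<in> emb_equiv S"
    using emb_equiv_iff[OF emb] \<sigma> a par relabel_apply[OF \<sigma>] by auto
qed

text \<open>Bijections between corresponding fibers are glued together.\<close>

lemma bij_betw_same_fibers:
  assumes fin: "finite A" "finite B"
    and card: "\<And>i. card {x \<in> A. f x = i} = card {y \<in> B. g y = i}"
  shows "\<exists>\<sigma>. bij_betw \<sigma> A B \<and> (\<forall>x\<in>A. g (\<sigma> x) = f x)"
proof -
  have "\<exists>h. bij_betw h {x \<in> A. f x = i} {y \<in> B. g y = i}" for i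
    using fin card by (intro finite_same_card_bij) auto
  then obtain h where h: "\<And>i. bij_betw (h i) {x \<in> A. f x = i} {y \<in> B. g y = i}" by metis
  define \<sigma> where "\<sigma> x = h (f x) x" for x
  have img: "\<sigma> x \<in> B" "g (\<sigma> x) = f x" if "x \<in> A" for x
    using bij_betw_apply[OF h[of "f x"], of x] that by (auto simp: \<sigma>_def)
  have "inj_on \<sigma> A"
  proof (rule inj_onI)
    fix x y assume xy: "x \<in> A" "y \<in> A" "\<sigma> x = \<sigma> y"
    then have "f x = f y" using img by metis
    then show "x = y" using xy h[of "f x"] by (auto simp: \<sigma>_def bij_betw_def inj_on_def)
  qed
  moreover have "y \<in> \<sigma> ` A" if y: "y \<in> B" for y
  proof -
    have "y \<in> h (g y) ` {x \<in> A. f x = g y}" using h[of "g y"] y by (auto simp: bij_betw_def)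
    then obtain x where "x \<in> A" "f x = g y" "y = h (g y) x" by auto
    then have "y = \<sigma> x" "x \<in> A" by (auto simp: \<sigma>_def)
    then show ?thesis by blast
  qed
  ultimately show ?thesis using img by (auto simp: bij_betw_def intro!: exI[of _ \<sigma>])
qed

text \<open>For finite \<open>V\<close> this is the group of abscissa-preserving permutations, by
  whose order the number of labelled trees is divided. Extensionality counts each permutation
  once.\<close>

definition label_perms :: "nat set \<Rightarrow> (nat \<Rightarrow> int) \<Rightarrow> (nat \<Rightarrow> nat) set" where
  "label_perms V a = {\<sigma> \<in> V \<rightarrow>\<^sub>E V. inj_on \<sigma> V \<and> (\<forall>v\<in>V. a (\<sigma> v) = a v)}"

section \<open>Isomorphism classes through one fixed labelling\<close>

context
  fixes S :: "int set" and l r :: int and n :: "int \<Rightarrow> nat" and a :: "nat \<Rightarrow> int" and m :: nat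
  assumes lr: "l \<le> r" and pos: "\<And>i. i \<in> {l..r} \<Longrightarrow> n i > 0"
    and zero: "\<And>i. i \<notin> {l..r} \<Longrightarrow> n i = 0"
    and a_ext: "a \<in> extensional {1..m}"
    and a_card: "\<And>i. card {v \<in> {1..m}. a v = i} = n i"
begin

definition standard_trees :: "emb_tree set" where
  "standard_trees = {T \<in> injective_S_embedded S. tsize T = m \<and> absc T = a}"

lemma labelling_size_pos: "m \<ge> 1"
proof (rule ccontr)
  assume "\<not> m \<ge> 1"
  then have "{v \<in> {1..m}. a v = l} = {}" by auto
  then have "n l = 0" using a_card[of l] by (simp only: card.empty)
  then show False using pos[of l] lr by auto
qed

lemma labelling_image: "a ` {1..m} = {l..r}"
proof -
  have "i \<in> a ` {1..m} \<longleftrightarrow> n i \<noteq> 0" for i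
    unfolding a_card[symmetric] by auto
  then show ?thesis using pos zero by (metis (no_types, lifting) ext order_less_irrefl set_eq_iff)
qed

lemma profile_fibers:
  assumes "has_profile T l r n" "verts T \<noteq> {}"
  shows "card {v \<in> verts T. absc T v = i} = n i"
proof (cases "i \<in> {l..r}")
  case True
  then show ?thesis using assms by (auto simp: has_profile_def)
next
  case False
  have "absc T v \<in> {l..r}" if "v \<in> verts T" for v
    using that assms finite_verts[of T] by (auto simp: has_profile_def)
  then have "{v \<in> verts T. absc T v = i} = {}" using False by auto
  then show ?thesis using zero[OF False] by (simp only: card.empty)
qed

lemma standard_profile:
  assumes "T \<in> standard_trees"
  shows "has_profile T l r n"
proof -
  have "verts T = {1..m}" "absc T = a" using assms by (auto simp: standard_trees_def verts_def)
  moreover have "Min {l..r} = l" "Max {l..r} = r" using lr by (auto intro: Min_eqI Max_eqI)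
  ultimately show ?thesis by (simp only: has_profile_def labelling_image a_card) simp
qed

text \<open>The abscissas of \<open>T\<close> and the fixed labelling \<open>a\<close> have equally
  large fibers, so some bijection matches them; \<open>T\<close> is relabelled along it.\<close>

lemma standard_representative:
  assumes T: "T \<in> injective_S_embedded S" and prof: "has_profile T l r n"
  shows "\<exists>T'\<in>standard_trees. (T, T') \<in> emb_equiv S"
proof -
  have "rooted_Cayley_tree T" using T by (auto simp: injective_S_embedded_def S_embedded_def)
  then have ne: "verts T \<noteq> {}" using root_in_verts by auto
  have "\<exists>\<sigma>. bij_betw \<sigma> (verts T) {1..m} \<and> (\<forall>v\<in>verts T. a (\<sigma> v) = absc T v)"
    by (rule bij_betw_same_fibers)
      (simp_all only: profile_fibers[OF prof ne] a_card finite_verts finite_atLeastAtMost)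
  then obtain \<sigma> where \<sigma>: "bij_betw \<sigma> (verts T) {1..m}" "\<And>v. v \<in> verts T \<Longrightarrow> a (\<sigma> v) = absc T v"
    by blast
  have m: "m = tsize T" using bij_betw_same_card[OF \<sigma>(1)] by (simp add: verts_def)
  let ?T' = "tree_of (tsize T) a (relabel (verts T) {1..tsize T} \<sigma> (parent_of T))"
  have "?T' \<in> injective_S_embedded S" "(T, ?T') \<in> emb_equiv S"
    using relabel_tree(1,2)[OF T \<sigma>(1)[unfolded m] a_ext[unfolded m]] \<sigma>(2) by blast+
  moreover from this have "?T' \<in> standard_trees" unfolding standard_trees_def using m by simp
  ultimately show ?thesis by blast
qed

lemma profile_classes: "S_ary_trees_with_profile S l r n = (\<lambda>T. emb_equiv S `` {T}) ` standard_trees"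
proof
  show "(\<lambda>T. emb_equiv S `` {T}) ` standard_trees \<subseteq> S_ary_trees_with_profile S l r n"
  proof (rule image_subsetI)
    fix T assume T: "T \<in> standard_trees"
    then have inj: "T \<in> injective_S_embedded S" by (auto simp: standard_trees_def)
    then have "T \<in> emb_equiv S `` {T}"
      using equiv_class_self[OF equiv_emb_equiv] by (auto simp: injective_S_embedded_def)
    then show "emb_equiv S `` {T} \<in> S_ary_trees_with_profile S l r n"
      using standard_profile[OF T] inj
      by (auto simp: S_ary_trees_with_profile_def S_ary_trees_def intro: quotientI)
  qed
  show "S_ary_trees_with_profile S l r n \<subseteq> (\<lambda>T. emb_equiv S `` {T}) ` standard_trees"
  proof
    fix C assume "C \<in> S_ary_trees_with_profile S l r n"
    then obtain T T1 where T: "T \<in> injective_S_embedded S" "C = emb_equiv S `` {T}"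
      and T1: "(T, T1) \<in> emb_equiv S" "has_profile T1 l r n"
      by (auto simp: S_ary_trees_with_profile_def S_ary_trees_def quotient_def)
    obtain T2 where T2: "T2 \<in> standard_trees" "(T1, T2) \<in> emb_equiv S"
      using standard_representative[OF injective_S_embedded_equiv[OF T(1) T1(1)] T1(2)] by auto
    have "(T, T2) \<in> emb_equiv S" using T1 T2 equiv_emb_equiv by (meson equivE transE)
    then have "C = emb_equiv S `` {T2}" using T equiv_class_eq[OF equiv_emb_equiv] by auto
    then show "C \<in> (\<lambda>T. emb_equiv S `` {T}) ` standard_trees" using T2 by auto
  qed
qed

lemma bij_parent_of: "bij_betw parent_of standard_trees (parent_funs S {1..m} a)"
proof (rule bij_betw_byWitness[where f' = "tree_of m a"])
  show "\<forall>T\<in>standard_trees. tree_of m a (parent_of T) = T"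
    using tree_of_parent_of by (auto simp: standard_trees_def injective_S_embedded_def S_embedded_def)
  show "\<forall>\<pi>\<in>parent_funs S {1..m} a. parent_of (tree_of m a \<pi>) = \<pi>"
    using tree_of_parent_fun(2)[OF _ a_ext labelling_size_pos] by auto
  show "parent_of ` standard_trees \<subseteq> parent_funs S {1..m} a"
    using parent_of_in_parent_funs by (force simp: standard_trees_def verts_def)
  show "tree_of m a ` parent_funs S {1..m} a \<subseteq> standard_trees"
    using tree_of_parent_fun(1)[OF _ a_ext labelling_size_pos] by (auto simp: standard_trees_def tree_of_def)
qed

text \<open>This is an orbit count: the permutations in \<open>label_perms\<close> act on the trees
  with abscissas \<open>a\<close>, the classes cut out the orbits, and rigidity makes the
  stabilizers trivial.\<close>

lemma card_standard_class:
  assumes T: "T \<in> standard_trees"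
  shows "card (emb_equiv S `` {T} \<inter> standard_trees) = card (label_perms {1..m} a)"
proof -
  let ?V = "{1..m}"
  have inj: "T \<in> injective_S_embedded S" and emb: "T \<in> S_embedded S" and m: "m = tsize T"
    and V: "verts T = ?V" and absc: "absc T = a"
    using T by (auto simp: standard_trees_def injective_S_embedded_def verts_def)
  have bij: "bij_betw \<sigma> ?V ?V" if "\<sigma> \<in> label_perms ?V a" for \<sigma>
    using that endo_inj_surj[of ?V \<sigma>] unfolding label_perms_def bij_betw_def by blast
  define h where "h \<sigma> = tree_of m a (relabel ?V ?V \<sigma> (parent_of T))" for \<sigma>
  have h: "h \<sigma> \<in> injective_S_embedded S" "(T, h \<sigma>) \<in> emb_equiv S"
    "parent_of (h \<sigma>) = relabel ?V ?V \<sigma> (parent_of T)" if \<sigma>: "\<sigma> \<in> label_perms ?V a" for \<sigma>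
  proof -
    have "bij_betw \<sigma> (verts T) {1..tsize T}" using bij[OF \<sigma>] V m by simp
    moreover have "a (\<sigma> v) = absc T v" if "v \<in> verts T" for v
      using that \<sigma> V absc by (auto simp: label_perms_def)
    ultimately show "h \<sigma> \<in> injective_S_embedded S" "(T, h \<sigma>) \<in> emb_equiv S"
      "parent_of (h \<sigma>) = relabel ?V ?V \<sigma> (parent_of T)"
      using relabel_tree[OF inj, of \<sigma> a] a_ext V by (auto simp: h_def m)
  qed
  have "bij_betw h (label_perms ?V a) (emb_equiv S `` {T} \<inter> standard_trees)"
  proof (rule bij_betw_imageI)
    show "inj_on h (label_perms ?V a)"
    proof (rule inj_onI)
      fix \<sigma> \<tau> assume st: "\<sigma> \<in> label_perms ?V a" "\<tau> \<in> label_perms ?V a" "h \<sigma> = h \<tau>"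
      let ?\<pi> = "parent_of (h \<sigma>)"
      \<comment> \<open>Both permutations are isomorphisms from \<open>T\<close> onto the same tree
        \<open>h \<sigma>\<close>, so rigidity identifies them.\<close>
      have *: "\<phi> v \<in> ?V \<and> a (\<phi> v) = a v \<and> ?\<pi> (\<phi> v) = map_option \<phi> (parent_of T v)"
        if "\<phi> \<in> {\<sigma>, \<tau>}" "v \<in> ?V" for \<phi> v
      proof -
        have \<phi>: "\<phi> \<in> label_perms ?V a" "h \<sigma> = h \<phi>" using that(1) st by auto
        then have "?\<pi> = relabel ?V ?V \<phi> (parent_of T)" using h(3) by simp
        then have "?\<pi> (\<phi> v) = map_option \<phi> (parent_of T v)"
          using relabel_apply[OF bij[OF \<phi>(1)] that(2)] by simp
        moreover have "\<phi> v \<in> ?V" "a (\<phi> v) = a v"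
          using \<phi>(1) that(2) unfolding label_perms_def by blast+
        ultimately show ?thesis by blast
      qed
      have "?\<pi> \<in> parent_funs S (verts (h \<sigma>)) (absc (h \<sigma>))"
        by (rule parent_of_in_parent_funs[OF h(1)[OF st(1)]])
      then have \<pi>: "?\<pi> \<in> parent_funs S ?V a" by (simp add: h_def tree_of_def verts_def)
      have "\<sigma> v = \<tau> v" if "v \<in> ?V" for v
        by (rule parent_funs_rigid[OF parent_of_in_parent_funs[OF inj, unfolded V absc] \<pi> _ * * that]) auto
      then show "\<sigma> = \<tau>" using st by (auto simp: label_perms_def intro: PiE_ext)
    qed
    show "h ` label_perms ?V a = emb_equiv S `` {T} \<inter> standard_trees"
    proof
      show "h ` label_perms ?V a \<subseteq> emb_equiv S `` {T} \<inter> standard_trees"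
        using h by (auto simp: standard_trees_def) (auto simp: h_def tree_of_def)
      show "emb_equiv S `` {T} \<inter> standard_trees \<subseteq> h ` label_perms ?V a"
      proof
        fix T' assume "T' \<in> emb_equiv S `` {T} \<inter> standard_trees"
        then have TT: "(T, T') \<in> emb_equiv S" and T': "T' \<in> standard_trees" by auto
        have emb': "T' \<in> S_embedded S" and V': "verts T' = ?V" and absc': "absc T' = a" and m': "tsize T' = m"
          using T' by (auto simp: standard_trees_def injective_S_embedded_def verts_def)
        obtain f where f: "bij_betw f ?V ?V" "\<And>v. v \<in> ?V \<Longrightarrow> a (f v) = a v"
            "\<And>v. v \<in> ?V \<Longrightarrow> parent_of T' (f v) = map_option f (parent_of T v)"
          using TT emb_equiv_iff[OF emb emb'] V V' absc absc' by auto
        \<comment> \<open>An isomorphism is arbitrary outside the vertices, whereas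
          \<open>label_perms\<close> consists of extensional maps.\<close>
        let ?\<sigma> = "restrict f ?V"
        have \<sigma>: "?\<sigma> \<in> label_perms ?V a"
          unfolding label_perms_def mem_Collect_eq inj_on_restrict_eq restrict_PiE_iff
          using bij_betw_apply[OF f(1)] bij_betw_imp_inj_on[OF f(1)] f(2) by (metis restrict_apply')
        have "parent_of T' v = relabel ?V ?V ?\<sigma> (parent_of T) v" if v: "v \<in> ?V" for v
        proof -
          obtain x where x: "x \<in> ?V" "v = f x" using bij_betw_imp_surj_on[OF f(1)] v by blast
          have "relabel ?V ?V ?\<sigma> (parent_of T) v = map_option ?\<sigma> (parent_of T x)"
            using relabel_apply[OF bij[OF \<sigma>] x(1)] x by auto
          also have "\<dots> = map_option f (parent_of T x)"
          proof (rule option.map_cong[OF refl])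
            fix z assume "z \<in> set_option (parent_of T x)"
            then have "z \<in> ?V"
              using parent_funsD(2)[OF parent_of_in_parent_funs[OF inj]] x(1) unfolding V by (metis elem_set)
            then show "?\<sigma> z = f z" by simp
          qed
          finally show ?thesis using f(3)[OF x(1)] x(2) by simp
        qed
        then have "parent_of T' = relabel ?V ?V ?\<sigma> (parent_of T)"
          by (intro extensionalityI[of _ ?V]) (auto simp: parent_of_def V' relabel_def)
        then have "T' = h ?\<sigma>"
          using tree_of_parent_of[of T'] emb' m' absc' by (auto simp: h_def S_embedded_def)
        then show "T' \<in> h ` label_perms ?V a" using \<sigma> by auto
      qed
    qed
  qed
  then show ?thesis by (simp add: bij_betw_same_card)
qed

lemma finite_parent_funs: "finite (parent_funs S {1..m} a)"
proof (rule finite_subset)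
  show "parent_funs S {1..m} a \<subseteq> {1..m} \<rightarrow>\<^sub>E insert None (Some ` {1..m})"
  proof
    fix \<pi> assume \<pi>: "\<pi> \<in> parent_funs S {1..m} a"
    have "\<pi> v \<in> insert None (Some ` {1..m})" if "v \<in> {1..m}" for v
      using parent_funsD(2)[OF \<pi> that] by (cases "\<pi> v") auto
    then show "\<pi> \<in> {1..m} \<rightarrow>\<^sub>E insert None (Some ` {1..m})"
      using \<pi> by (auto simp: parent_funs_def PiE_def)
  qed
  show "finite ({1..m} \<rightarrow>\<^sub>E insert None (Some ` {1..m}))" by (intro finite_PiE) auto
qed

text \<open>The classes cut \<open>standard_trees\<close> into blocks, all of the size found in
  \<open>card_standard_class\<close>.\<close>

theorem label_perms_times_classes:
  "finite (S_ary_trees_with_profile S l r n)"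
  "card (label_perms {1..m} a) * card (S_ary_trees_with_profile S l r n) = card (parent_funs S {1..m} a)"
proof -
  let ?X = standard_trees and ?C = "S_ary_trees_with_profile S l r n"
  note eq = equiv_emb_equiv[of S]
  have fin: "finite ?X" using bij_betw_finite[OF bij_parent_of] finite_parent_funs by auto
  then show finC: "finite ?C" unfolding profile_classes by auto
  have XS: "T \<in> S_embedded S" if "T \<in> ?X" for T
    using that by (auto simp: standard_trees_def injective_S_embedded_def)
  have self: "T \<in> emb_equiv S `` {T}" if "T \<in> ?X" for T
    using equiv_class_self[OF eq XS[OF that]] .
  \<comment> \<open>The blocks are nonempty, hence determine their classes and may be counted in
    their place.\<close>
  have inj: "inj_on (\<lambda>C. C \<inter> ?X) ?C"
  proof (rule inj_onI)
    fix C C' assume C: "C \<in> ?C" "C' \<in> ?C" "C \<inter> ?X = C' \<inter> ?X"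
    then obtain T T' where T: "T \<in> ?X" "C = emb_equiv S `` {T}" "C' = emb_equiv S `` {T'}" "T' \<in> ?X"
      unfolding profile_classes by auto
    then have "T \<in> C'" using self C by blast
    then show "C = C'" using T equiv_class_eq[OF eq] by auto
  qed
  let ?P = "(\<lambda>C. C \<inter> ?X) ` ?C"
  have "card (label_perms {1..m} a) * card ?P = card (\<Union>?P)"
  proof (rule card_partition)
    show "finite ?P" using finC by simp
    show "finite (\<Union>?P)" by (rule finite_subset[OF _ fin]) auto
    show "card c = card (label_perms {1..m} a)" if "c \<in> ?P" for c
      using that card_standard_class unfolding profile_classes by auto
    show "c1 \<inter> c2 = {}" if c: "c1 \<in> ?P" "c2 \<in> ?P" "c1 \<noteq> c2" for c1 c2
    proof (rule ccontr)
      obtain T1 T2 where T: "T1 \<in> ?X" "T2 \<in> ?X" "c1 = emb_equiv S `` {T1} \<inter> ?X" "c2 = emb_equiv S `` {T2} \<inter> ?X"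
        using c unfolding profile_classes by auto
      assume "c1 \<inter> c2 \<noteq> {}"
      then obtain x where "(T1, x) \<in> emb_equiv S" "(T2, x) \<in> emb_equiv S" using T by auto
      then have "emb_equiv S `` {T1} = emb_equiv S `` {T2}"
        using equiv_class_eq[OF eq] by metis
      then show False using T c by auto
    qed
  qed
  moreover have "\<Union>?P = ?X" using self unfolding profile_classes by auto
  moreover have "card ?P = card ?C" by (rule card_image[OF inj])
  ultimately show "card (label_perms {1..m} a) * card ?C = card (parent_funs S {1..m} a)"
    using bij_betw_same_card[OF bij_parent_of] by simp
qed

end

section \<open>The counting formula\<close>

interpretation discrete: type_forest "\<lambda>_. None" "(=)" "\<lambda>_. 0"
  by unfold_locales auto

text \<open>The general count is reused with the vertices themselves as ownerless slots, which makes
  acyclicity vacuous. In the edgeless type forest every slot is an entry slot, so an abscissa with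
  \<open>n\<close> vertices contributes \<open>n * fact (n - 1)\<close>.\<close>

lemma card_label_perms:
  assumes "finite V"
  shows "card (label_perms V a) = (\<Prod>i\<in>a ` V. fact (card {v \<in> V. a v = i}))"
proof -
  have "label_perms V a = slot_maps a a (\<lambda>_. None) V V"
    by (auto simp: label_perms_def slot_maps_def acyclic_def)
  also have "card \<dots> = (\<Prod>i\<in>a ` V. card (discrete.entry_slots a a (\<lambda>_. None) V i) *
       (fact (card {v \<in> V. a v = i} - 1) *
         ((card {q \<in> V. a q = i} - 1) choose (card {v \<in> V. a v = i} - 1))))"
    using assms by (intro discrete.card_slot_maps) auto
  also have "\<dots> = (\<Prod>i\<in>a ` V. fact (card {v \<in> V. a v = i}))"
  proof (rule prod.cong[OF refl])
    fix i assume "i \<in> a ` V"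
    then have "card {v \<in> V. a v = i} > 0" using assms by (auto simp: card_gt_0_iff)
    then show "card (discrete.entry_slots a a (\<lambda>_. None) V i) *
       (fact (card {v \<in> V. a v = i} - 1) *
         ((card {q \<in> V. a q = i} - 1) choose (card {v \<in> V. a v = i} - 1))) =
       fact (card {v \<in> V. a v = i})"
      by (simp add: discrete.entry_slots_def fact_reduce)
  qed
  finally show ?thesis .
qed

text \<open>As a child is at most one step to the right of its parent (and, if \<open>l < 0\<close>, at most one step
  to the left), the abscissas on the way from the root to a vertex at abscissa \<open>i\<close> include all those
  between \<open>0\<close> and \<open>i\<close>. Hence the type forest is the path \<open>l, \<dots>, r\<close> rooted at \<open>0\<close>.\<close>

definition spine_parent :: "int \<Rightarrow> int option" where
  "spine_parent i = (if i = 0 then None else if i > 0 then Some (i - 1) else Some (i + 1))"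

text \<open>At \<open>i = 0\<close> both implications are vacuous: every abscissa descends from the
  root type.\<close>

definition spine_desc :: "int \<Rightarrow> int \<Rightarrow> bool" where
  "spine_desc i j \<longleftrightarrow> (i > 0 \<longrightarrow> i \<le> j) \<and> (i < 0 \<longrightarrow> j \<le> i)"

interpretation spine: type_forest spine_parent spine_desc "\<lambda>i. nat \<bar>i\<bar>"
  by unfold_locales (auto simp: spine_parent_def spine_desc_def split: if_splits)

text \<open>The slot \<open>(Some w, i)\<close> holds the child of \<open>w\<close> at abscissa \<open>i\<close>; the slot \<open>(None, 0)\<close> holds the
  root.\<close>

definition child_slots :: "int set \<Rightarrow> nat set \<Rightarrow> (nat \<Rightarrow> int) \<Rightarrow> (nat option \<times> int) set" where
  "child_slots S V a = insert (None, 0) {(Some w, i) | w i. w \<in> V \<and> i \<in> a ` V \<and> i - a w \<in> S}"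

text \<open>A slot is a pair of its owner \<open>fst\<close> and its abscissa \<open>snd\<close>.
  Since the abscissa is forced by the vertex, only the owner is free, and that is the
  parent.\<close>

lemma bij_parent_funs_slot_maps:
  "bij_betw (\<lambda>\<pi>. \<lambda>v\<in>V. (\<pi> v, a v)) (parent_funs S V a) (slot_maps a snd fst V (child_slots S V a))"
proof (rule bij_betw_byWitness[where f' = "\<lambda>f. \<lambda>v\<in>V. fst (f v)"])
  have rel: "{(v, u). v \<in> V \<and> fst ((\<lambda>v\<in>V. (\<pi> v, a v)) v) = Some u} = parent_rel V \<pi>" for \<pi>
    by (auto simp: parent_rel_def)
  have rel': "parent_rel V (\<lambda>v\<in>V. fst (f v)) = {(v, u). v \<in> V \<and> fst (f v) = Some u}"
    for f :: "nat \<Rightarrow> nat option \<times> int"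
    by (auto simp: parent_rel_def)
  show "\<forall>\<pi>\<in>parent_funs S V a. (\<lambda>v\<in>V. fst ((\<lambda>v\<in>V. (\<pi> v, a v)) v)) = \<pi>"
    by (auto simp: parent_funs_def fun_eq_iff extensional_def)
  show "\<forall>f\<in>slot_maps a snd fst V (child_slots S V a). (\<lambda>v\<in>V. ((\<lambda>v\<in>V. fst (f v)) v, a v)) = f"
    by (auto simp: slot_maps_def fun_eq_iff PiE_def extensional_def intro!: prod_eqI)
  show "(\<lambda>\<pi>. \<lambda>v\<in>V. (\<pi> v, a v)) ` parent_funs S V a \<subseteq> slot_maps a snd fst V (child_slots S V a)"
  proof (rule image_subsetI)
    fix \<pi> assume \<pi>: "\<pi> \<in> parent_funs S V a"
    have "(\<pi> v, a v) \<in> child_slots S V a" if "v \<in> V" for v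
      using parent_funsD[OF \<pi> that] that by (cases "\<pi> v") (auto simp: child_slots_def)
    then have "(\<lambda>v\<in>V. (\<pi> v, a v)) \<in> V \<rightarrow>\<^sub>E child_slots S V a" by auto
    then show "(\<lambda>v\<in>V. (\<pi> v, a v)) \<in> slot_maps a snd fst V (child_slots S V a)"
      using \<pi> unfolding slot_maps_def mem_Collect_eq rel by (simp add: parent_funs_def)
  qed
  show "(\<lambda>f. \<lambda>v\<in>V. fst (f v)) ` slot_maps a snd fst V (child_slots S V a) \<subseteq> parent_funs S V a"
  proof (rule image_subsetI)
    fix f assume f: "f \<in> slot_maps a snd fst V (child_slots S V a)"
    then have fV: "f v \<in> child_slots S V a" "snd (f v) = a v" if "v \<in> V" for v
      using that by (auto simp: slot_maps_def)
    have inj: "inj_on f V" and ac: "acyclic {(v, u). v \<in> V \<and> fst (f v) = Some u}"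
      using f by (auto simp: slot_maps_def)
    have "inj_on (\<lambda>v. (fst (f v), a v)) V \<longleftrightarrow> inj_on f V"
      by (rule inj_on_cong) (use fV(2) in \<open>metis prod.collapse\<close>)
    moreover have "case fst (f v) of None \<Rightarrow> a v = 0 | Some u \<Rightarrow> u \<in> V \<and> a v - a u \<in> S" if "v \<in> V" for v
    proof -
      obtain o' i where "f v = (o', i)" by (cases "f v")
      then show ?thesis using fV[OF that] by (cases o') (auto simp: child_slots_def)
    qed
    ultimately show "(\<lambda>v\<in>V. fst (f v)) \<in> parent_funs S V a"
      using inj ac by (simp add: parent_funs_def rel' inj_on_def)
  qed
qed

text \<open>By \<open>up\<close> and \<open>down\<close>, a slot at \<open>i \<noteq> 0\<close>
  belongs to a vertex one step closer to \<open>0\<close>, or at \<open>i\<close> or beyond it on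
  the same side; this is the invariant of \<open>spine.card_slot_maps\<close>. The assumptions
  \<open>S\<close> make each vertex one step closer own exactly one slot at
  \<open>i\<close>.\<close>

lemma card_parent_funs:
  assumes fin: "finite V"
    and up: "\<And>w i. w \<in> V \<Longrightarrow> i \<in> a ` V \<Longrightarrow> i - a w \<in> S \<Longrightarrow> i \<le> a w + 1"
    and down: "\<And>w i. w \<in> V \<Longrightarrow> i \<in> a ` V \<Longrightarrow> i - a w \<in> S \<Longrightarrow> i < 0 \<Longrightarrow> a w \<le> i + 1"
    and S: "1 \<in> S" "\<And>v. v \<in> V \<Longrightarrow> a v < 0 \<Longrightarrow> -1 \<in> S"
  shows "card (parent_funs S V a) = (\<Prod>i\<in>a ` V.
    (if i = 0 then 1 else if i > 0 then card {v \<in> V. a v = i - 1} else card {v \<in> V. a v = i + 1}) *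
    (fact (card {v \<in> V. a v = i} - 1) *
      ((card {w \<in> V. i - a w \<in> S} - (if i = 0 then 0 else 1)) choose (card {v \<in> V. a v = i} - 1))))"
proof -
  let ?Q = "child_slots S V a"
  \<comment> \<open>Slots are offered only at occupied abscissas, which keeps their number finite
    even if \<open>S\<close> is infinite.\<close>
  have finQ: "finite ?Q"
    by (rule finite_subset[of _ "insert (None, 0) (Some ` V \<times> a ` V)"]) (use fin in \<open>auto simp: child_slots_def\<close>)
  have "card (parent_funs S V a) = card (slot_maps a snd fst V ?Q)"
    by (rule bij_betw_same_card[OF bij_parent_funs_slot_maps])
  also have "\<dots> = (\<Prod>i\<in>a ` V. card (spine.entry_slots a snd fst ?Q i) *
       (fact (card {v \<in> V. a v = i} - 1) *
         ((card {q \<in> ?Q. snd q = i} - 1) choose (card {v \<in> V. a v = i} - 1))))"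
  proof (rule spine.card_slot_maps[OF fin finQ])
    show "u \<in> V" if "q \<in> ?Q" "fst q = Some u" for q u
      using that by (auto simp: child_slots_def)
    fix q assume q: "q \<in> ?Q" "snd q \<in> a ` V"
    show "map_option a (fst q) = spine_parent (snd q) \<or> (\<exists>u. fst q = Some u \<and> spine_desc (snd q) (a u))"
    proof (cases "fst q")
      case None
      then show ?thesis using q by (auto simp: child_slots_def spine_parent_def)
    next
      case (Some w)
      then have w: "w \<in> V" "snd q - a w \<in> S" using q by (auto simp: child_slots_def)
      then show ?thesis using up[OF w(1) q(2) w(2)] down[OF w(1) q(2) w(2)] Some
        by (auto simp: spine_parent_def spine_desc_def)
    qed
  qed
  also have "\<dots> = (\<Prod>i\<in>a ` V.
    (if i = 0 then 1 else if i > 0 then card {v \<in> V. a v = i - 1} else card {v \<in> V. a v = i + 1}) *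
    (fact (card {v \<in> V. a v = i} - 1) *
      ((card {w \<in> V. i - a w \<in> S} - (if i = 0 then 0 else 1)) choose (card {v \<in> V. a v = i} - 1))))"
  proof (rule prod.cong[OF refl])
    fix i assume i: "i \<in> a ` V"
    \<comment> \<open>The slot of the root adds one at \<open>i = 0\<close> and cancels the
      \<open>- 1\<close> of the general count there, so one is subtracted only for
      \<open>i \<noteq> 0\<close>.\<close>
    have all: "card {q \<in> ?Q. snd q = i} = (if i = 0 then 1 else 0) + card {w \<in> V. i - a w \<in> S}"
    proof -
      have eq: "{q \<in> ?Q. snd q = i} =
        (if i = 0 then {(None, 0)} else {}) \<union> (\<lambda>w. (Some w, i)) ` {w \<in> V. i - a w \<in> S}"
        using i by (auto simp: child_slots_def)
      show ?thesis unfolding eq using fin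
        by (subst card_Un_disjoint) (auto simp: card_image inj_on_def)
    qed
    have entry: "card (spine.entry_slots a snd fst ?Q i) =
      (if i = 0 then 1 else if i > 0 then card {v \<in> V. a v = i - 1} else card {v \<in> V. a v = i + 1})"
    proof -
      have eq: "spine.entry_slots a snd fst ?Q i = (if i = 0 then {(None, 0)}
        else if i > 0 then (\<lambda>w. (Some w, i)) ` {v \<in> V. a v = i - 1}
        else (\<lambda>w. (Some w, i)) ` {v \<in> V. a v = i + 1})"
        using i S by (auto simp: spine.entry_slots_def child_slots_def spine_parent_def)
      show ?thesis unfolding eq by (simp add: card_image inj_on_def)
    qed
    show "card (spine.entry_slots a snd fst ?Q i) *
       (fact (card {v \<in> V. a v = i} - 1) *
         ((card {q \<in> ?Q. snd q = i} - 1) choose (card {v \<in> V. a v = i} - 1))) =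
      (if i = 0 then 1 else if i > 0 then card {v \<in> V. a v = i - 1} else card {v \<in> V. a v = i + 1}) *
      (fact (card {v \<in> V. a v = i} - 1) *
        ((card {w \<in> V. i - a w \<in> S} - (if i = 0 then 0 else 1)) choose (card {v \<in> V. a v = i} - 1)))"
      unfolding all entry by simp
  qed
  finally show ?thesis .
qed

section \<open>Evaluation of the product\<close>

text \<open>The factors for \<open>i > 0\<close> run from \<open>n 0\<close> to
  \<open>n (r - 1)\<close>, those for \<open>i < 0\<close> from \<open>n (l + 1)\<close> to
  \<open>n 0\<close>. Supplying \<open>n r\<close> and \<open>n l\<close> completes both runs, and
  together they contain \<open>n 0\<close> twice.\<close>

lemma spine_product:
  fixes n :: "int \<Rightarrow> nat"
  assumes "l \<le> 0" "0 \<le> r"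
  shows "(\<Prod>i\<in>{l..r}. if i = 0 then 1 else if i > 0 then n (i - 1) else n (i + 1)) * (n l * n r) =
    n 0 * (\<Prod>i\<in>{l..r}. n i)"
proof -
  let ?k = "\<lambda>i. if i = 0 then 1 else if i > 0 then n (i - 1) else n (i + 1)"
  have split: "(\<Prod>i\<in>{l..r}. f i) = (\<Prod>i\<in>{l..-1}. f i) * (f 0 * (\<Prod>i\<in>{1..r}. f i))" for f :: "int \<Rightarrow> nat"
  proof -
    have "{l..r} = {l..-1} \<union> insert 0 {1..r}" using assms by auto
    moreover have "(\<Prod>i\<in>{l..-1} \<union> insert 0 {1..r}. f i) = (\<Prod>i\<in>{l..-1}. f i) * (\<Prod>i\<in>insert 0 {1..r}. f i)"
      by (rule prod.union_disjoint) auto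
    ultimately show ?thesis by simp
  qed
  have up: "(\<Prod>i\<in>{1..r}. ?k i) * n r = n 0 * (\<Prod>i\<in>{1..r}. n i)"
  proof -
    have "(\<Prod>i\<in>{1..r}. ?k i) = (\<Prod>i\<in>{0..r-1}. n i)"
      by (rule prod.reindex_bij_witness[of _ "\<lambda>i. i + 1" "\<lambda>i. i - 1"]) auto
    moreover have "{0..r} = insert r {0..r-1}" "{0..r} = insert 0 {1..r}" using assms by auto
    then have "n r * (\<Prod>i\<in>{0..r-1}. n i) = n 0 * (\<Prod>i\<in>{1..r}. n i)"
      by (metis (no_types, lifting) prod.insert atLeastAtMost_iff finite_atLeastAtMost_int zle_diff1_eq less_irrefl
          not_one_le_zero)
    ultimately show ?thesis by (simp add: mult.commute)
  qed
  have down: "(\<Prod>i\<in>{l..-1}. ?k i) * n l = n 0 * (\<Prod>i\<in>{l..-1}. n i)"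
  proof -
    have "(\<Prod>i\<in>{l..-1}. ?k i) = (\<Prod>i\<in>{l+1..0}. n i)"
      by (rule prod.reindex_bij_witness[of _ "\<lambda>i. i - 1" "\<lambda>i. i + 1"]) auto
    moreover have "{l..0} = insert l {l+1..0}" "{l..0} = insert 0 {l..-1}" using assms by auto
    then have "n l * (\<Prod>i\<in>{l+1..0}. n i) = n 0 * (\<Prod>i\<in>{l..-1}. n i)"
      by (metis (no_types, lifting) prod.insert atLeastAtMost_iff finite_atLeastAtMost_int zless_add1_eq
          add1_zle_eq less_irrefl neg_0_le_iff_le not_one_le_zero)
    ultimately show ?thesis by (simp add: mult.commute)
  qed
  have "(\<Prod>i\<in>{l..r}. ?k i) * (n l * n r) =
    ((\<Prod>i\<in>{l..-1}. ?k i) * n l) * ((\<Prod>i\<in>{1..r}. ?k i) * n r)"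
    unfolding split by simp
  also have "\<dots> = n 0 * (\<Prod>i\<in>{l..r}. n i)"
    unfolding up down unfolding split by simp
  finally show ?thesis .
qed

text \<open>The vertices that may have a child at \<open>i\<close> are sorted by their abscissa
  \<open>j = i - s\<close>.\<close>

lemma shifted_sum_eq_card:
  assumes fin: "finite V" and card: "\<And>i. card {v \<in> V. a v = i} = n i"
  shows "shifted_sum S n i = card {w \<in> V. i - a w \<in> S}"
proof -
  have n0: "n j \<noteq> 0 \<longleftrightarrow> j \<in> a ` V" for j
    unfolding card[symmetric] using fin by auto
  have "shifted_sum S n i = (\<Sum>j | i - j \<in> S \<and> j \<in> a ` V. n j)"
    unfolding shifted_sum_def n0
    by (rule sum.reindex_bij_witness[of _ "\<lambda>j. i - j" "\<lambda>s. i - s"]) auto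
  also have "\<dots> = (\<Sum>j | i - j \<in> S \<and> j \<in> a ` V. card {v \<in> V. a v = j})" by (simp add: card)
  also have "\<dots> = card (\<Union>j\<in>{j. i - j \<in> S \<and> j \<in> a ` V}. {v \<in> V. a v = j})"
    using fin by (intro card_UN_disjoint[symmetric]) auto
  also have "(\<Union>j\<in>{j. i - j \<in> S \<and> j \<in> a ` V}. {v \<in> V. a v = j}) = {w \<in> V. i - a w \<in> S}" by auto
  finally show ?thesis .
qed

text \<open>The labels enumerate a disjoint union of sets with \<open>n i\<close> elements.\<close>

lemma exists_labelling:
  fixes n :: "int \<Rightarrow> nat"
  assumes "finite I" "\<And>i. i \<notin> I \<Longrightarrow> n i = 0"
  shows "\<exists>m a. a \<in> extensional {1..m} \<and> (\<forall>i. card {v \<in> {1..m::nat}. a v = i} = n i)"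
proof -
  let ?B = "SIGMA i : I. {..<n i}"
  define m where "m = card ?B"
  have finB: "finite ?B" using assms by auto
  then obtain h where h: "bij_betw h {1..m} ?B"
    using ex_bij_betw_nat_finite_1 m_def by blast
  define a where "a = (\<lambda>v\<in>{1..m}. fst (h v))"
  have "card {v \<in> {1..m}. a v = i} = n i" for i
  proof -
    have "{b \<in> ?B. fst b = i} = {b \<in> h ` {1..m}. fst b = i}"
      using bij_betw_imp_surj_on[OF h] by simp
    also have "\<dots> = h ` {v \<in> {1..m}. fst (h v) = i}" by blast
    also have "{v \<in> {1..m}. fst (h v) = i} = {v \<in> {1..m}. a v = i}" by (auto simp: a_def)
    finally have "card {b \<in> ?B. fst b = i} = card (h ` {v \<in> {1..m}. a v = i})" by simp
    also have "\<dots> = card {v \<in> {1..m}. a v = i}"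
      by (rule card_image, rule inj_on_subset[OF bij_betw_imp_inj_on[OF h]]) blast
    finally have "card {v \<in> {1..m}. a v = i} = card {b \<in> ?B. fst b = i}" ..
    also have "{b \<in> ?B. fst b = i} = (if i \<in> I then Pair i ` {..<n i} else {})" by auto
    also have "card \<dots> = n i" using assms(2) by (auto simp: card_image inj_on_def)
    finally show ?thesis .
  qed
  then show ?thesis by (intro exI[of _ m] exI[of _ a]) (auto simp: a_def)
qed

text \<open>The number of parent functions over one labelling is divided by the number of label
  permutations. The factors \<open>fact (n i - 1)\<close> cancel, and \<open>spine_product\<close>
  turns the quotient of the entry factors by the \<open>n i\<close> into
  \<open>n 0 / (n l * n r)\<close>.\<close>

theorem theorem2p2:
  fixes S :: "int set" and l r :: int and n :: "int \<Rightarrow> nat"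
  assumes "1 \<in> S" and "\<forall>s\<in>S. s \<le> 1"
    and "l \<le> 0" and "0 \<le> r"
    and "\<forall>i\<in>{l..r}. n i > 0"
    and "\<forall>i. i < l \<or> i > r \<longrightarrow> n i = 0"
    and "(-1 \<in> S \<and> (\<forall>s\<in>S. -1 \<le> s)) \<or> l = 0"
  shows "finite (S_ary_trees_with_profile S l r n) \<and>
    real (card (S_ary_trees_with_profile S l r n)) =
      real (n 0) / (real (n l) * real (n r)) *
      real (shifted_sum S n 0 choose (n 0 - 1)) *
      (\<Prod>i\<in>{l..r} - {0}. real ((shifted_sum S n i - 1) choose (n i - 1)))"
proof -
  have lr: "l \<le> r" and pos: "\<And>i. i \<in> {l..r} \<Longrightarrow> n i > 0" and zero: "\<And>i. i \<notin> {l..r} \<Longrightarrow> n i = 0"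
    using assms by auto
  have "\<exists>m a. a \<in> extensional {1..m} \<and> (\<forall>i. card {v \<in> {1..m::nat}. a v = i} = n i)"
    by (rule exists_labelling[of "{l..r}"]) (simp, rule zero)
  then obtain m :: nat and a
    where a: "a \<in> extensional {1..m}" and card: "\<And>i. card {v \<in> {1..m}. a v = i} = n i"
    by blast
  let ?V = "{1..m}" and ?C = "S_ary_trees_with_profile S l r n"
  have img: "a ` ?V = {l..r}" by (rule labelling_image[where n = n]) (fact lr pos zero a card)+
  have range: "l \<le> a v" "a v \<le> r" if "v \<in> ?V" for v
    using img that by auto
  let ?k = "\<lambda>i. if i = 0 then 1 else if i > 0 then n (i - 1) else n (i + 1)"
  let ?b = "\<lambda>i. (shifted_sum S n i - (if i = 0 then 0 else 1)) choose (n i - 1)"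
  have "card (parent_funs S ?V a) = (\<Prod>i\<in>a ` ?V.
    (if i = 0 then 1 else if i > 0 then card {v \<in> ?V. a v = i - 1} else card {v \<in> ?V. a v = i + 1}) *
    (fact (card {v \<in> ?V. a v = i} - 1) *
      ((card {w \<in> ?V. i - a w \<in> S} - (if i = 0 then 0 else 1)) choose (card {v \<in> ?V. a v = i} - 1))))"
  proof (rule card_parent_funs)
    show "i \<le> a w + 1" if "w \<in> ?V" "i \<in> a ` ?V" "i - a w \<in> S" for w i
      using bspec[OF assms(2) that(3)] by auto
    show "a w \<le> i + 1" if "w \<in> ?V" "i \<in> a ` ?V" "i - a w \<in> S" "i < 0" for w i
    proof -
      \<comment> \<open>An occupied negative abscissa excludes \<open>l = 0\<close>, so the lower
        bound on \<open>S\<close> is available.\<close>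
      have "l \<noteq> 0" using that(2,4) unfolding img by auto
      then have "- 1 \<le> i - a w" using assms(7) that(3) by blast
      then show ?thesis by auto
    qed
    show "- 1 \<in> S" if "v \<in> ?V" "a v < 0" for v
      using range[OF that(1)] that(2) assms(7) by auto
  qed (use assms in auto)
  then have pf: "card (parent_funs S ?V a) = (\<Prod>i\<in>{l..r}. ?k i * (fact (n i - 1) * ?b i))"
    unfolding img card shifted_sum_eq_card[OF finite_atLeastAtMost card, symmetric] .
  have lp: "card (label_perms ?V a) = (\<Prod>i\<in>{l..r}. fact (n i))"
    using card_label_perms[of ?V a] unfolding img card by simp
  have cc: "finite ?C" "card (label_perms ?V a) * card ?C = card (parent_funs S ?V a)"
    by (rule label_perms_times_classes; fact lr pos zero a card)+
  \<comment> \<open>Here \<open>N * F\<close> will be the number of label permutations and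
    \<open>K * F * B\<close> the number of parent functions.\<close>
  define F where "F = (\<Prod>i\<in>{l..r}. fact (n i - 1) :: nat)"
  define B where "B = (\<Prod>i\<in>{l..r}. ?b i)"
  define K where "K = (\<Prod>i\<in>{l..r}. ?k i)"
  define N where "N = (\<Prod>i\<in>{l..r}. n i)"
  have "(\<Prod>i\<in>{l..r}. fact (n i)) = (\<Prod>i\<in>{l..r}. n i * fact (n i - 1))"
    by (rule prod.cong[OF refl]) (use pos in \<open>simp add: fact_reduce\<close>)
  then have "N * F * card ?C = K * F * B"
    using cc(2) unfolding lp pf by (simp add: prod.distrib F_def B_def K_def N_def mult.assoc)
  moreover have "F > 0" by (simp add: F_def)
  ultimately have *: "N * card ?C = K * B" by simp
  have Kn: "K * (n l * n r) = n 0 * N"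
    unfolding K_def N_def by (rule spine_product[OF assms(3,4)])
  have Npos: "N > 0" unfolding N_def using pos by (simp add: prod_pos)
  have npos: "n l > 0" "n r > 0" using pos assms by auto
  have "N * (card ?C * (n l * n r)) = K * (n l * n r) * B" using * by (metis mult.assoc mult.commute)
  also have "\<dots> = N * (n 0 * B)" unfolding Kn by simp
  finally have "card ?C * (n l * n r) = n 0 * B" using Npos by simp
  then have "real (card ?C) * (real (n l) * real (n r)) = real (n 0) * real B" by (metis of_nat_mult)
  then have "real (card ?C) = real (n 0) / (real (n l) * real (n r)) * real B"
    using npos by (simp add: field_simps)
  \<comment> \<open>The index \<open>0\<close> is split off because it is the only one at which
    \<open>?b\<close> does not subtract one.\<close>
  also have "B = (shifted_sum S n 0 choose (n 0 - 1)) *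
    (\<Prod>i\<in>{l..r} - {0}. (shifted_sum S n i - 1) choose (n i - 1))"
    unfolding B_def by (subst prod.remove[of _ 0]) (use assms in auto)
  finally show ?thesis using cc(1) by (simp add: mult.assoc)
qed

end
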